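(* Let $\nu\in\mathbb{C}$ with $\operatorname{Re}\nu>-\tfrac12$, and let $w,z\in\mathbb{C}\setminus\{0\}$ with $|w/z|<1$, where moreover $z\notin(-\infty,0]$ if $\nu\notin\mathbb{N}_0$. Then the Lommel function of two variables $U_\nu(w,z)$ satisfies $$U_\nu(w,z)=\frac{\mathrm{i}^\nu}{\pi}\left(\frac wz\right)^{\nu}\int_0^\pi\frac{P\big(\{\nu\},-\mathrm{i}z(1+\cos\theta)\big)\,\big[\cos(\nu\theta)-(w/z)^2\cos((\nu-2)\theta)\big]}{1-2(w/z)^2\cos2\theta+(w/z)^4}\,e^{-\mathrm{i}z\cos\theta}\,\mathrm{d}\theta .$$
   Context: The Lommel function of two variables is defined by the Neumann series $U_\nu(w,z)=\sum_{n=0}^\infty(-1)^n\left(\frac wz\right)^{\nu+2n}J_{\nu+2n}(z)$, where $J_\mu(z)=\left(\frac z2\right)^\mu\sum_{k=0}^\infty\frac{(-1)^k(z/2)^{2k}}{k!\,\Gamma(\mu+k+1)}$ is the Bessel function of the first kind with the principal branch of the power. The same determination of $(w/z)^\nu$ is used in the definition and in the formula, with $(w/z)^{\nu+2n}=(w/z)^\nu(w/z)^{2n}$. $\mathbb{N}_0=\{0,1,2,\ldots\}$ and $\mathrm{i}^\nu=e^{\mathrm{i}\pi\nu/2}$. The complex fractional part of $\nu$ is $\{\nu\}=\nu-[\operatorname{Re}\nu]$, where for real $x$, $[x]=\lfloor x\rfloor$ if $x\ge0$ and $[x]=\lceil x\rceil$ if $x<0$. $P(a,s)=\gamma(a,s)/\Gamma(a)$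 is the regularized lower incomplete gamma function, where $\gamma(a,s)=\int_0^s t^{a-1}e^{-t}\,\mathrm{d}t$ for $\operatorname{Re}a>0$. It is extended analytically to other $a$ by $P(a,s)=s^a\gamma^*(a,s)$, where $\gamma^*(a,s)=e^{-s}\sum_{n=0}^\infty\frac{s^n}{\Gamma(a+n+1)}$ is entire in both $a$ and $s$ (with $1/\Gamma=0$ at the poles of $\Gamma$). In particular $P(0,s)=1$. Branch convention: the power of $-\mathrm{i}z(1+\cos\theta)$ contained in $P$ is taken with the phase of $-\mathrm{i}z$ equal to $\operatorname{ph}z-\pi/2$, where $\operatorname{ph}z$ is principal. Equivalently, $$\mathrm{i}^\nu P(\{\nu\},-\mathrm{i}z(1+\cos\theta))=\mathrm{i}^{[\operatorname{Re}\nu]}z^{\{\nu\}}(1+\cos\theta)^{\{\nu\}}\gamma^*(\{\nu\},-\mathrm{i}z(1+\cos\theta)),$$ with the principal branch of $z^{\{\nu\}}$. *)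

theory Defs
  imports "HOL-Analysis.Analysis"
begin

text \<open>Bessel function of the first kind; powr on complex numbers is the principal branch.\<close>

definition bessel_J :: "complex \<Rightarrow> complex \<Rightarrow> complex" where
  "bessel_J \<mu> z =
     (z / 2) powr \<mu> * (\<Sum>k. (-1) ^ k * (z / 2) ^ (2 * k) / fact k * rGamma (\<mu> + of_nat k + 1))"

text \<open>
  The function U of order \<nu> is multivalued in w/z. The determination is selected by a logarithm L
  of w/z, that is \<^term>\<open>exp L = w / z\<close>, and exp (\<nu> L) is the corresponding value of the
  \<nu>-th power of w/z.
\<close>

definition lommel_U_term :: "complex \<Rightarrow> complex \<Rightarrow> complex \<Rightarrow> complex \<Rightarrow> nat \<Rightarrow> complex" where
  "lommel_U_term L \<nu> w z n =
     (-1) ^ n * (exp (\<nu> * L) * (w / z) ^ (2 * n)) * bessel_J (\<nu> + 2 * of_nat n) z"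

definition lommel_U :: "complex \<Rightarrow> complex \<Rightarrow> complex \<Rightarrow> complex \<Rightarrow> complex" where
  "lommel_U L \<nu> w z = (\<Sum>n. lommel_U_term L \<nu> w z n)"

definition trunc_int :: "real \<Rightarrow> int" where
  "trunc_int x = (if x \<ge> 0 then \<lfloor>x\<rfloor> else \<lceil>x\<rceil>)"

definition cfrac_part :: "complex \<Rightarrow> complex" where
  "cfrac_part \<nu> = \<nu> - of_int (trunc_int (Re \<nu>))"

text \<open>
  The power of s with exponent a when s is given the phase \<phi>, not necessarily in (-\<pi>, \<pi>]. The case
  distinction makes the exponent 0 give 1 also at s = 0, where powr would give 0.
\<close>

definition phase_powr :: "real \<Rightarrow> complex \<Rightarrow> complex \<Rightarrow> complex" where
  "phase_powr \<phi> s a =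
     (if a = 0 then 1 else of_real (norm s) powr a * exp (\<i> * a * of_real \<phi>))"

definition gamma_star :: "complex \<Rightarrow> complex \<Rightarrow> complex" where
  "gamma_star a s = exp (- s) * (\<Sum>n. s ^ n * rGamma (a + of_nat n + 1))"

text \<open>The regularized lower incomplete gamma function P(a,s), with s given the phase \<phi>.\<close>

definition reg_inc_gamma :: "real \<Rightarrow> complex \<Rightarrow> complex \<Rightarrow> complex" where
  "reg_inc_gamma \<phi> a s = phase_powr \<phi> s a * gamma_star a s"

text \<open>
  The lower incomplete gamma integral from 0 to s along the segment t = u s. The lemma
  \<open>reg_inc_gamma_eq\<close> below shows that P(a,s) is its quotient by \<Gamma>(a) when Re a > 0.
\<close>

definition lower_inc_gamma :: "real \<Rightarrow> complex \<Rightarrow> complex \<Rightarrow> complex" where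
  "lower_inc_gamma \<phi> a s =
     integral {0..1} (\<lambda>u. phase_powr \<phi> (of_real u * s) (a - 1) * exp (- (of_real u * s)) * s)"

text \<open>The phase Arg z - \<pi>/2 of -\<i>z ranges over (-3\<pi>/2, \<pi>/2], so it need not be principal.\<close>

definition lommel_integrand :: "complex \<Rightarrow> complex \<Rightarrow> complex \<Rightarrow> real \<Rightarrow> complex" where
  "lommel_integrand \<nu> w z \<theta> =
     reg_inc_gamma (Arg z - pi / 2) (cfrac_part \<nu>) (- \<i> * z * of_real (1 + cos \<theta>)) *
     (cos (\<nu> * of_real \<theta>) - (w / z) ^ 2 * cos ((\<nu> - 2) * of_real \<theta>)) /
     (1 - 2 * (w / z) ^ 2 * of_real (cos (2 * \<theta>)) + (w / z) ^ 4) *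
     exp (- \<i> * z * of_real (cos \<theta>))"

lemma integral_powr_exp_step:
  fixes b s :: complex
  assumes b: "Re b > 0"
  shows "((\<lambda>t. of_real t powr (b - 1) * exp (- (of_real t * s))
              - s / b * (of_real t powr b * exp (- (of_real t * s))))
            has_integral exp (- s) / b) {0..1}"
proof -
  have [simp]: "b \<noteq> 0" using b by auto
  let ?G = "\<lambda>t. complex_of_real t powr b * exp (- (of_real t * s)) / b"
  have "((\<lambda>t. of_real t powr (b - 1) * exp (- (of_real t * s))
              - s / b * (of_real t powr b * exp (- (of_real t * s))))
            has_integral (?G 1 - ?G 0)) {0..1}"
  proof (rule fundamental_theorem_of_calculus_interior)
    show "continuous_on {0..1} ?G"
      using b by (auto intro!: continuous_intros)
    fix t :: real assume t: "t \<in> {0<..<1}"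
    have "((\<lambda>z. z powr b * exp (- (z * s)) / b) has_field_derivative
             (of_real t powr (b - 1) * exp (- (of_real t * s))
              - s / b * (of_real t powr b * exp (- (of_real t * s))))) (at (of_real t))"
      using t by (auto intro!: derivative_eq_intros simp: field_simps)
    thus "(?G has_vector_derivative
             (of_real t powr (b - 1) * exp (- (of_real t * s))
              - s / b * (of_real t powr b * exp (- (of_real t * s))))) (at t)"
      by (rule has_vector_derivative_real_field)
  qed auto
  thus ?thesis by simp
qed

lemma pow_over_pochhammer_tendsto_0:
  fixes a s :: complex
  assumes a: "Re a > 0"
  shows "(\<lambda>k. s ^ k / pochhammer a k) \<longlonglongrightarrow> 0"
proof -
  have [simp]: "a \<noteq> 0" using a by auto
  have le: "real n \<le> norm (a + of_nat n)" for n
    using a complex_Re_le_cmod [of "a + of_nat n"] by simp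
  have fle: "norm a * fact k \<le> norm (pochhammer a (Suc k))" for k
  proof (induction k)
    case (Suc k)
    have "norm a * fact (Suc k) = (norm a * fact k) * real (Suc k)" by simp
    also have "\<dots> \<le> norm (pochhammer a (Suc k)) * norm (a + of_nat (Suc k))"
      by (rule mult_mono [OF Suc.IH le]) auto
    also have "\<dots> = norm (pochhammer a (Suc (Suc k)))"
      unfolding pochhammer_Suc [of a "Suc k"] norm_mult ..
    finally show ?case .
  qed auto
  have "(\<lambda>k. norm s / norm a * (norm s ^ k /\<^sub>R fact k)) \<longlonglongrightarrow> norm s / norm a * 0"
    by (intro tendsto_intros summable_LIMSEQ_zero summable_exp_generic)
  hence lim: "(\<lambda>k. norm s / norm a * (norm s ^ k /\<^sub>R fact k)) \<longlonglongrightarrow> 0"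
    by simp
  have "(\<lambda>k. s ^ Suc k / pochhammer a (Suc k)) \<longlonglongrightarrow> 0"
  proof (rule Lim_null_comparison [OF always_eventually lim], rule allI)
    fix k
    have "norm (s ^ Suc k / pochhammer a (Suc k)) \<le> norm s ^ Suc k / (norm a * fact k)"
      unfolding norm_divide norm_power by (rule divide_left_mono [OF fle]) (use fle [of k] in
        \<open>auto intro!: mult_pos_pos less_le_trans [OF _ fle [of k]]\<close>)
    also have "\<dots> = norm s / norm a * (norm s ^ k /\<^sub>R fact k)"
      by (simp add: field_simps)
    finally show "norm (s ^ Suc k / pochhammer a (Suc k)) \<le> norm s / norm a * (norm s ^ k /\<^sub>R fact k)" .
  qed
  thus ?thesis by (rule LIMSEQ_imp_Suc)
qed

lemma integral_powr_exp:
  fixes a s :: complex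
  assumes a: "Re a > 0"
  shows "((\<lambda>t. of_real t powr (a - 1) * exp (- (of_real t * s)))
            has_integral Gamma a * gamma_star a s) {0..1}"
proof -
  let ?c = "\<lambda>k. s ^ k / pochhammer a k"
  let ?g = "\<lambda>t. of_real t powr (a - 1) * exp (- (of_real t * s))"
  let ?r = "\<lambda>k t. of_real t powr (a + of_nat k - 1) * exp (- (of_real t * s))"
  let ?f = "\<lambda>k t. ?g t - ?c k * ?r k t"
  have a': "a \<notin> \<int>\<^sub>\<le>\<^sub>0"
    using a by (auto elim!: nonpos_Ints_cases)
  have poch: "s ^ n / pochhammer a (Suc n) = Gamma a * (s ^ n * rGamma (a + of_nat n + 1))" for n
  proof -
    have "rGamma a \<noteq> 0" using a' by (simp add: rGamma_eq_zero_iff)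
    moreover have "rGamma a = pochhammer a (Suc n) * rGamma (a + of_nat n + 1)"
      using pochhammer_rGamma [of a "Suc n"] by (simp add: add_ac)
    ultimately show ?thesis by (auto simp: Gamma_def field_simps)
  qed
  have part: "(?f k has_integral exp (- s) * (\<Sum>n<k. s ^ n / pochhammer a (Suc n))) {0..1}" for k
  proof (induction k)
    case 0
    show ?case by simp
  next
    case (Suc k)
    have nz: "a + of_nat k \<noteq> 0"
      using a by (auto simp: complex_eq_iff)
    have "((\<lambda>t. ?c k * (?r k t - s / (a + of_nat k) *
               (of_real t powr (a + of_nat k) * exp (- (of_real t * s)))))
             has_integral ?c k * (exp (- s) / (a + of_nat k))) {0..1}"
      by (intro has_integral_mult_right integral_powr_exp_step) (use a in auto)
    from has_integral_add [OF Suc.IH this] show ?case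
    proof (rule has_integral_eq_rhs [OF has_integral_eq, rotated])
      fix t :: real
      show "?g t - ?c k * ?r k t + ?c k * (?r k t - s / (a + of_nat k) *
               (of_real t powr (a + of_nat k) * exp (- (of_real t * s)))) = ?f (Suc k) t"
        by (simp add: pochhammer_Suc right_diff_distrib)
    next
      show "exp (- s) * (\<Sum>n<Suc k. s ^ n / pochhammer a (Suc n)) =
              exp (- s) * (\<Sum>n<k. s ^ n / pochhammer a (Suc n)) + ?c k * (exp (- s) / (a + of_nat k))"
        by (simp add: pochhammer_Suc distrib_left)
    qed
  qed
  obtain M where M: "\<And>k. norm (?c k) \<le> M"
    using convergent_imp_Bseq [OF convergentI [OF pow_over_pochhammer_tendsto_0 [OF a]]]
    unfolding Bseq_def by blast
  hence M0: "0 \<le> M" using norm_ge_zero order.trans by blast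
  let ?h = "\<lambda>t. t powr (Re a - 1) * (exp (norm s) * (1 + M))"
  have h: "?h integrable_on {0..1}"
    using has_integral_mult_left [OF has_integral_powr_from_0 [of "Re a - 1" 1]] a
    by (force simp: integrable_on_def)
  have bound: "norm (?f k t) \<le> ?h t" if t: "t \<in> {0..1}" for k t
  proof -
    have "norm (exp (- (of_real t * s))) \<le> exp (norm (- (of_real t * s)))"
      by (rule norm_exp)
    also have "\<dots> \<le> exp (norm s)"
      using t by (auto simp: norm_mult mult_left_le_one_le)
    finally have e: "norm (exp (- (of_real t * s))) \<le> exp (norm s)" .
    have p: "norm (complex_of_real t powr (a + of_nat k - 1)) \<le> t powr (Re a - 1)" for k
      using t by (cases "t = 0") (auto simp: norm_powr_real_powr intro!: powr_mono')
    have r: "norm (?r k t) \<le> t powr (Re a - 1) * exp (norm s)" for k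
      unfolding norm_mult by (intro mult_mono p e) auto
    have "norm (?f k t) \<le> norm (?g t) + norm (?c k) * norm (?r k t)"
      by (metis norm_mult norm_triangle_ineq4)
    also have "\<dots> \<le> t powr (Re a - 1) * exp (norm s) + M * (t powr (Re a - 1) * exp (norm s))"
      using r [of 0] by (intro add_mono mult_mono r M M0) auto
    finally show ?thesis by (simp add: algebra_simps)
  qed
  have conv: "(\<lambda>k. ?f k t) \<longlonglongrightarrow> ?g t" if t: "t \<in> {0..1}" for t
  proof -
    have B: "norm (?r k t) \<le> norm (?g t)" for k
      using t by (cases "t = 0") (auto simp: norm_mult norm_powr_real_powr intro!: powr_mono' mult_right_mono)
    have "(\<lambda>k. norm (?c k) * norm (?g t)) \<longlonglongrightarrow> 0"
      by (intro tendsto_mult_left_zero tendsto_norm_zero pow_over_pochhammer_tendsto_0 a)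
    hence "(\<lambda>k. ?c k * ?r k t) \<longlonglongrightarrow> 0"
    proof (rule Lim_null_comparison [OF always_eventually, rotated], rule_tac allI)
      show "norm (?c k * ?r k t) \<le> norm (?c k) * norm (?g t)" for k
        unfolding norm_mult [of "?c k"] by (intro mult_left_mono B) auto
    qed
    thus ?thesis using tendsto_diff [OF tendsto_const] by fastforce
  qed
  have int: "?f k integrable_on {0..1}" for k
    using part by blast
  note dc = dominated_convergence [of ?f "{0..1}" ?h ?g, OF int h bound conv]
  have "(\<lambda>k. exp (- s) * (\<Sum>n<k. s ^ n / pochhammer a (Suc n))) \<longlonglongrightarrow> integral {0..1} ?g"
    using dc(2) integral_unique [OF part] by simp
  hence "(\<lambda>k. rGamma a * exp s * (exp (- s) * (\<Sum>n<k. s ^ n / pochhammer a (Suc n))))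
            \<longlonglongrightarrow> rGamma a * exp s * integral {0..1} ?g"
    by (intro tendsto_intros)
  moreover have Gr: "rGamma a * Gamma a = 1"
    using a' by (simp add: Gamma_def rGamma_eq_zero_iff)
  have "rGamma a * exp s * (exp (- s) * (\<Sum>n<k. s ^ n / pochhammer a (Suc n)))
          = (\<Sum>n<k. s ^ n * rGamma (a + of_nat n + 1))" for k
  proof -
    have "rGamma a * exp s * (exp (- s) * (\<Sum>n<k. s ^ n / pochhammer a (Suc n)))
        = (rGamma a * Gamma a) * (exp s * exp (- s)) * (\<Sum>n<k. s ^ n * rGamma (a + of_nat n + 1))"
      unfolding poch sum_distrib_left [symmetric] by (simp only: mult_ac)
    thus ?thesis by (simp add: Gr flip: exp_add)
  qed
  ultimately have "(\<lambda>n. s ^ n * rGamma (a + of_nat n + 1)) sums (rGamma a * exp s * integral {0..1} ?g)"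
    by (simp add: sums_def)
  hence "Gamma a * gamma_star a s
           = (rGamma a * Gamma a) * (exp s * exp (- s)) * integral {0..1} ?g"
    unfolding gamma_star_def by (simp add: sums_iff mult_ac)
  thus ?thesis
    using dc(1) by (simp add: has_integral_iff Gr flip: exp_add)
qed

lemma reg_inc_gamma_eq:
  assumes a: "Re a > 0" and s: "s = of_real (norm s) * cis \<phi>"
  shows "reg_inc_gamma \<phi> a s = lower_inc_gamma \<phi> a s / Gamma a"
proof (cases "s = 0")
  case True
  thus ?thesis using a by (auto simp: reg_inc_gamma_def lower_inc_gamma_def phase_powr_def)
next
  case False
  have G: "Gamma a \<noteq> 0"
    using a by (auto simp: Gamma_eq_zero_iff elim!: nonpos_Ints_cases)
  have pw: "phase_powr \<phi> (of_real u * s) (a - 1) * s = phase_powr \<phi> s a * of_real u powr (a - 1)"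
    if u: "u > 0" for u
  proof -
    have gen: "phase_powr \<phi> v b = exp (b * (of_real (ln (norm v)) + \<i> * of_real \<phi>))"
      if "v \<noteq> 0" for v b
      using that
      by (auto simp: phase_powr_def powr_def Ln_of_real algebra_simps simp flip: exp_add)
    have "s = exp (of_real (ln (norm s)) + \<i> * of_real \<phi>)"
      using s False by (simp add: exp_add cis_conv_exp exp_of_real)
    moreover have "complex_of_real u powr (a - 1) = exp ((a - 1) * of_real (ln u))"
      using u by (simp add: powr_def Ln_of_real)
    moreover have "ln (norm (of_real u * s)) = ln u + ln (norm s)"
      using u False by (simp add: norm_mult ln_mult)
    ultimately have "phase_powr \<phi> (of_real u * s) (a - 1) * s =
        exp ((a - 1) * (of_real (ln u + ln (norm s)) + \<i> * of_real \<phi>)) *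
        exp (of_real (ln (norm s)) + \<i> * of_real \<phi>)"
      and "phase_powr \<phi> s a * of_real u powr (a - 1) =
        exp (a * (of_real (ln (norm s)) + \<i> * of_real \<phi>)) * exp ((a - 1) * of_real (ln u))"
      using gen [of "of_real u * s" "a - 1"] gen [of s a] u False by simp_all
    thus ?thesis
      by (simp add: exp_add [symmetric] algebra_simps)
  qed
  have "((\<lambda>t. phase_powr \<phi> s a * (of_real t powr (a - 1) * exp (- (of_real t * s))))
            has_integral phase_powr \<phi> s a * (Gamma a * gamma_star a s)) {0..1}"
    by (intro has_integral_mult_right integral_powr_exp a)
  hence "((\<lambda>u. phase_powr \<phi> (of_real u * s) (a - 1) * exp (- (of_real u * s)) * s)
            has_integral phase_powr \<phi> s a * (Gamma a * gamma_star a s)) {0..1}"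
  proof (rule has_integral_spike_finite [of "{0}", rotated 2])
    fix u :: real assume "u \<in> {0..1} - {0}"
    hence "u > 0" by auto
    from pw [OF this]
    show "phase_powr \<phi> (of_real u * s) (a - 1) * exp (- (of_real u * s)) * s =
          phase_powr \<phi> s a * (of_real u powr (a - 1) * exp (- (of_real u * s)))"
      by (metis mult.assoc mult.commute)
  qed auto
  thus ?thesis
    unfolding lower_inc_gamma_def reg_inc_gamma_def using G by (subst integral_unique) auto
qed

lemma reg_inc_gamma_0 [simp]: "reg_inc_gamma \<phi> 0 s = 1"
proof -
  have "(\<Sum>n. s ^ n * rGamma (of_nat n + 1)) = exp s"
    unfolding exp_def
    by (intro suminf_cong) (simp add: Gamma_fact rGamma_inverse_Gamma scaleR_conv_of_real add.commute)
  thus ?thesis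
    by (simp add: reg_inc_gamma_def phase_powr_def gamma_star_def flip: exp_add)
qed

end

(*
  Substituting the series of gamma_star into the Bessel integral leaves the Cauchy integrals
  int_0^pi (1 + cos t)^b cos(mu t) dt with b - mu an integer. They satisfy a first-order recurrence
  in mu, vanish for mu = b + 1, b + 2, ..., and for mu = b are given by the mean value property of
  (1 + u)^(2b) on the unit disc. What remains is e^(iz) times a confluent hypergeometric series in
  -iz/2; by Kummer's second formula, read off from the differential equation at the level of formal
  power series, it is the series of J_mu(z). Hence for Re a > -1/2 and every natural number m
    J_(a+m)(z) = i^(a+m) / pi int_0^pi P(a, -iz(1 + cos t)) cos((a+m)t) e^(-iz cos t) dt,
  in which a need not be the fractional part of a + m. Therefore the same a serves all the orders
  nu + 2n, also when Re nu < 0, and the Neumann series becomes a geometric series under the integral.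
*)

theory Submission
  imports Defs "HOL-Complex_Analysis.Complex_Analysis"
begin

subsection \<open>Integrals dominated by powers of \<open>1 + cos \<theta>\<close>\<close>

lemma one_plus_cos_pos:
  assumes "0 \<le> \<theta>" "\<theta> < pi"
  shows "0 < 1 + cos \<theta>"
  using cos_monotone_0_pi[of \<theta> pi] assms by simp

text \<open>The factor \<open>sin \<theta>\<close> makes the integrand an exact derivative, and
  \<open>r + 1 / 2 > 0\<close> keeps the primitive continuous at pi, where
  \<open>1 + cos \<theta>\<close> vanishes.\<close>

lemma integrable_sin_one_plus_cos_powr:
  fixes r :: real
  assumes r: "r > - 1 / 2"
  shows "(\<lambda>\<theta>. sin \<theta> * (1 + cos \<theta>) powr (r - 1 / 2)) integrable_on {0..pi}"
proof -
  define s where "s = r + 1 / 2"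
  have s: "s > 0" using r by (simp add: s_def)
  let ?F = "\<lambda>\<theta>. - ((1 + cos \<theta>) powr s) / s"
  have "((\<lambda>\<theta>. sin \<theta> * (1 + cos \<theta>) powr (s - 1)) has_integral (?F pi - ?F 0)) {0..pi}"
  proof (rule fundamental_theorem_of_calculus_interior)
    show "continuous_on {0..pi} ?F"
      using s cos_ge_minus_one
      by (auto intro!: continuous_intros continuous_on_powr' simp: add.commute[of 1] real_0_le_add_iff)
    fix \<theta> :: real assume \<theta>: "\<theta> \<in> {0<..<pi}"
    have pos: "1 + cos \<theta> > 0" using one_plus_cos_pos \<theta> by auto
    have "(?F has_real_derivative sin \<theta> * (1 + cos \<theta>) powr (s - 1)) (at \<theta>)"
      using pos s by (auto intro!: derivative_eq_intros)
    thus "(?F has_vector_derivative sin \<theta> * (1 + cos \<theta>) powr (s - 1)) (at \<theta>)"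
      by (simp add: has_real_derivative_iff_has_vector_derivative)
  qed auto
  thus ?thesis by (auto simp: s_def)
qed

text \<open>Where \<open>1 + cos \<theta> < 1\<close>, the identity sin^2 = (1 + cos)(1 - cos) makes
  \<open>sin \<theta>\<close> at least the square root of \<open>1 + cos \<theta>\<close>, so
  trading half a power for a sine only increases the value. Elsewhere the constant suffices.\<close>

lemma one_plus_cos_powr_le:
  fixes r :: real
  assumes \<theta>: "\<theta> \<in> {0<..<pi}"
  shows "(1 + cos \<theta>) powr r \<le> 2 powr \<bar>r\<bar> + sin \<theta> * (1 + cos \<theta>) powr (r - 1 / 2)"
proof -
  define c where "c = 1 + cos \<theta>"
  have c: "0 < c" "c \<le> 2" using one_plus_cos_pos \<theta> by (auto simp: c_def)
  have s: "sin \<theta> \<ge> 0" using \<theta> by (auto intro: sin_ge_zero)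
  show ?thesis
  proof (cases "c \<ge> 1")
    case True
    have "c powr r \<le> c powr \<bar>r\<bar>" using True by (intro powr_mono) auto
    also have "\<dots> \<le> 2 powr \<bar>r\<bar>" using True c by (intro powr_mono2) auto
    finally show ?thesis using s by (simp add: c_def add_increasing2)
  next
    case False
    have "(sin \<theta>)\<^sup>2 = c * (2 - c)"
      by (simp add: c_def sin_squared_eq algebra_simps power2_eq_square)
    also have "\<dots> \<ge> c * 1" using False c by (intro mult_left_mono) auto
    finally have "sqrt c \<le> sin \<theta>" using s by (intro real_le_lsqrt) auto
    hence "c powr (1 / 2) * c powr (r - 1 / 2) \<le> sin \<theta> * c powr (r - 1 / 2)"
      using c by (intro mult_right_mono) (auto simp: powr_half_sqrt)
    also have "c powr (1 / 2) * c powr (r - 1 / 2) = c powr r" by (simp flip: powr_add)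
    finally show ?thesis by (simp add: c_def add_increasing)
  qed
qed

text \<open>Near pi the function behaves like a multiple of (pi - \<theta>)^(2r), which is where the
  threshold -1/2 comes from.\<close>

lemma integrable_one_plus_cos_powr:
  fixes r :: real
  assumes r: "r > - 1 / 2"
  shows "(\<lambda>\<theta>. (1 + cos \<theta>) powr r) integrable_on {0<..<pi}"
proof (rule measurable_bounded_by_integrable_imp_integrable)
  have "1 + cos \<theta> \<noteq> 0" if "0 < \<theta>" "\<theta> < pi" for \<theta>
    using one_plus_cos_pos[of \<theta>] that by simp
  thus "(\<lambda>\<theta>. (1 + cos \<theta>) powr r) \<in> borel_measurable (lebesgue_on {0<..<pi})"
    by (intro continuous_imp_measurable_on_sets_lebesgue continuous_on_powr continuous_intros) auto
  show "(\<lambda>\<theta>. 2 powr \<bar>r\<bar> + sin \<theta> * (1 + cos \<theta>) powr (r - 1 / 2)) integrable_on {0<..<pi}"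
    using integrable_sin_one_plus_cos_powr[OF r]
    by (auto intro: integrable_add integrable_const_ivl simp flip: integrable_on_Icc_iff_Ioo)
qed (use one_plus_cos_powr_le in auto)

lemma integrable_weight_bounded:
  fixes u :: "real \<Rightarrow> complex"
  assumes r: "r > - 1 / 2" and u: "continuous_on {0<..<pi} u"
    and le: "\<And>\<theta>. \<theta> \<in> {0<..<pi} \<Longrightarrow> norm (u \<theta>) \<le> C * (1 + cos \<theta>) powr r"
  shows "u integrable_on {0<..<pi}"
proof (rule measurable_bounded_by_integrable_imp_integrable)
  show "u \<in> borel_measurable (lebesgue_on {0<..<pi})"
    by (intro continuous_imp_measurable_on_sets_lebesgue u) auto
  show "(\<lambda>\<theta>. C * (1 + cos \<theta>) powr r) integrable_on {0<..<pi}"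
    using integrable_on_mult_right[OF integrable_one_plus_cos_powr[OF r]] by simp
qed (use le in auto)

text \<open>Dominated convergence with the majorant
  \<open>C * (1 + cos \<theta>) powr r * suminf M\<close>: the singularity at pi sits in
  \<open>u\<close> alone, so the functions \<open>f n\<close> need only a Weierstrass bound. It
  serves twice, for the series of \<open>gamma_star\<close> and for the Neumann series.\<close>

lemma integral_series_weight_bounded:
  fixes u :: "real \<Rightarrow> complex" and f :: "nat \<Rightarrow> real \<Rightarrow> complex"
  assumes r: "r > - 1 / 2" and u: "continuous_on {0<..<pi} u"
    and ule: "\<And>\<theta>. \<theta> \<in> {0<..<pi} \<Longrightarrow> norm (u \<theta>) \<le> C * (1 + cos \<theta>) powr r"
    and f: "\<And>n. continuous_on {0<..<pi} (f n)"
    and fle: "\<And>n \<theta>. \<theta> \<in> {0<..<pi} \<Longrightarrow> norm (f n \<theta>) \<le> M n" and M: "summable M"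
    and fs: "\<And>\<theta>. \<theta> \<in> {0<..<pi} \<Longrightarrow> (\<lambda>n. f n \<theta>) sums F \<theta>"
  shows "(\<lambda>\<theta>. u \<theta> * F \<theta>) integrable_on {0<..<pi}"
    and "(\<lambda>n. integral {0<..<pi} (\<lambda>\<theta>. u \<theta> * f n \<theta>)) sums integral {0<..<pi} (\<lambda>\<theta>. u \<theta> * F \<theta>)"
proof -
  let ?S = "{0<..<pi}"
  \<comment> \<open>Any point of the interval would do: it turns \<open>fle\<close> into
    \<open>M n \<ge> 0\<close>.\<close>
  have "pi / 2 \<in> ?S" using pi_gt_zero by auto
  hence M0: "0 \<le> M n" for n
    using fle norm_ge_zero order.trans by blast
  have part: "norm (\<Sum>n<k. f n \<theta>) \<le> suminf M" if "\<theta> \<in> ?S" for k \<theta>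
    using norm_sum[of "\<lambda>n. f n \<theta>" "{..<k}"] sum_mono[of "{..<k}" "\<lambda>n. norm (f n \<theta>)" M] fle[OF that]
      sum_le_suminf[OF M, of "{..<k}"] M0 by fastforce
  have int: "(\<lambda>\<theta>. u \<theta> * f n \<theta>) integrable_on ?S" for n
  proof (rule integrable_weight_bounded[OF r])
    show "continuous_on ?S (\<lambda>\<theta>. u \<theta> * f n \<theta>)" by (intro continuous_intros u f)
    show "norm (u \<theta> * f n \<theta>) \<le> C * M n * (1 + cos \<theta>) powr r" if "\<theta> \<in> ?S" for \<theta>
      using mult_mono[OF ule[OF that] fle[OF that, of n]] order.trans[OF norm_ge_zero ule[OF that]]
      by (simp add: norm_mult mult_ac)
  qed
  have h: "(\<lambda>\<theta>. C * (1 + cos \<theta>) powr r * suminf M) integrable_on ?S"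
    using integrable_on_mult_right[OF integrable_one_plus_cos_powr[OF r], of "C * suminf M"]
    by (simp add: mult_ac)
  note dc = dominated_convergence[of "\<lambda>k \<theta>. \<Sum>n<k. u \<theta> * f n \<theta>" ?S _ "\<lambda>\<theta>. u \<theta> * F \<theta>", OF _ h]
  have le: "norm (\<Sum>n<k. u \<theta> * f n \<theta>) \<le> C * (1 + cos \<theta>) powr r * suminf M" if "\<theta> \<in> ?S" for k \<theta>
    using mult_mono[OF ule[OF that] part[OF that, of k]] order.trans[OF norm_ge_zero ule[OF that]]
    by (simp add: norm_mult flip: sum_distrib_left)
  have conv: "(\<lambda>k. \<Sum>n<k. u \<theta> * f n \<theta>) \<longlonglongrightarrow> u \<theta> * F \<theta>" if "\<theta> \<in> ?S" for \<theta>
    using sums_mult[OF fs[OF that], of "u \<theta>"] by (simp add: sums_def)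
  have sumint: "(\<lambda>\<theta>. \<Sum>n<k. u \<theta> * f n \<theta>) integrable_on ?S" for k
    by (intro integrable_sum int) auto
  show "(\<lambda>\<theta>. u \<theta> * F \<theta>) integrable_on ?S"
    by (rule dc(1)[OF sumint le conv])
  have "(\<lambda>k. integral ?S (\<lambda>\<theta>. \<Sum>n<k. u \<theta> * f n \<theta>)) \<longlonglongrightarrow> integral ?S (\<lambda>\<theta>. u \<theta> * F \<theta>)"
    by (rule dc(2)[OF sumint le conv])
  thus "(\<lambda>n. integral ?S (\<lambda>\<theta>. u \<theta> * f n \<theta>)) sums integral ?S (\<lambda>\<theta>. u \<theta> * F \<theta>)"
    by (simp add: sums_def integral_sum int)
qed

subsection \<open>Cauchy's cosine integral\<close>

text \<open>\<open>cos (\<theta> / 2)\<close> is positive on the interval, so the double-angle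
  formula passes through complex powers with no branch correction.\<close>

lemma powr_one_plus_cos_half:
  fixes b :: complex
  assumes \<theta>: "\<theta> \<in> {0<..<pi}"
  shows "of_real (1 + cos \<theta>) powr b = 2 powr b * of_real (cos (\<theta> / 2)) powr (2 * b)"
proof -
  define c where "c = cos (\<theta> / 2)"
  have c: "c > 0" using \<theta> by (auto simp: c_def intro: cos_gt_zero_pi)
  have "1 + cos \<theta> = 2 * c\<^sup>2" using cos_double_cos[of "\<theta> / 2"] by (simp add: c_def)
  hence "complex_of_real (1 + cos \<theta>) powr b = of_real (2 * c\<^sup>2) powr b" by simp
  also have "\<dots> = exp (b * of_real (ln (2 * c\<^sup>2)))"
    using c by (subst powr_def) (auto simp: Ln_of_real simp del: of_real_mult of_real_power)
  also have "of_real (ln (2 * c\<^sup>2)) = complex_of_real (ln 2) + 2 * of_real (ln c)"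
    using c by (simp add: ln_mult ln_realpow)
  also have "exp (b * \<dots>) = 2 powr b * of_real c powr (2 * b)"
    using c Ln_of_real[of 2] by (auto simp: powr_def Ln_of_real algebra_simps exp_add)
  finally show ?thesis by (simp add: c_def)
qed

text \<open>The bound depends on \<open>\<mu>\<close> only through its imaginary part, so it is the
  same for all orders \<open>\<nu> + 2 * of_nat n\<close>.\<close>

lemma norm_cos_mult_real_le:
  fixes \<mu> :: complex
  assumes "0 \<le> \<theta>" "\<theta> \<le> pi"
  shows "norm (cos (\<mu> * of_real \<theta>)) \<le> exp (pi * \<bar>Im \<mu>\<bar>)"
proof -
  have le: "\<bar>Im \<mu> * \<theta>\<bar> \<le> pi * \<bar>Im \<mu>\<bar>"
    using mult_right_mono[of \<theta> pi "\<bar>Im \<mu>\<bar>"] assms by (simp add: abs_mult mult.commute)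
  have "norm (exp (\<i> * (\<mu> * of_real \<theta>))) \<le> exp (pi * \<bar>Im \<mu>\<bar>)"
       "norm (exp (- (\<i> * (\<mu> * of_real \<theta>)))) \<le> exp (pi * \<bar>Im \<mu>\<bar>)"
    using le by auto
  hence "norm (exp (\<i> * (\<mu> * of_real \<theta>)) + exp (- (\<i> * (\<mu> * of_real \<theta>)))) \<le> 2 * exp (pi * \<bar>Im \<mu>\<bar>)"
    using norm_triangle_ineq[of "exp (\<i> * (\<mu> * of_real \<theta>))" "exp (- (\<i> * (\<mu> * of_real \<theta>)))"] by linarith
  thus ?thesis by (simp add: cos_exp_eq norm_divide)
qed

lemma norm_one_plus_cos_powr:
  fixes b :: complex
  assumes "\<theta> \<in> {0<..<pi}"
  shows "norm (complex_of_real (1 + cos \<theta>) powr b) = (1 + cos \<theta>) powr Re b"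
  using one_plus_cos_pos[of \<theta>] assms by (subst norm_powr_real_powr) auto

lemma continuous_on_one_plus_cos_powr:
  fixes b :: complex
  shows "continuous_on {0<..<pi} (\<lambda>\<theta>. complex_of_real (1 + cos \<theta>) powr b)"
proof (intro continuous_intros)
  show "{0<..<pi} \<subseteq> {\<theta>. Re (complex_of_real (1 + cos \<theta>)) \<ge> 0 \<or> Im (complex_of_real (1 + cos \<theta>)) \<noteq> 0}"
    using one_plus_cos_pos by (auto simp: less_imp_le)
  fix \<theta> :: real assume "\<theta> \<in> {0<..<pi}" "complex_of_real (1 + cos \<theta>) = 0"
  thus "Re b > 0" using one_plus_cos_pos[of \<theta>]
    by (metis greaterThanLessThan_iff less_eq_real_def less_irrefl of_real_eq_0_iff)
qed

text \<open>Under \<theta> = 2t this is 2^(b+1) times Cauchy's integral of cos(t)^(2b) cos(2 \<mu>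
  t) over (0, pi/2).\<close>

definition cos_integral :: "complex \<Rightarrow> complex \<Rightarrow> complex" where
  "cos_integral b \<mu> = integral {0<..<pi} (\<lambda>\<theta>. of_real (1 + cos \<theta>) powr b * cos (\<mu> * of_real \<theta>))"

lemma integrable_cos_integral:
  assumes "Re b > - 1 / 2"
  shows "(\<lambda>\<theta>. of_real (1 + cos \<theta>) powr b * cos (\<mu> * of_real \<theta>)) integrable_on {0<..<pi}"
proof (rule integrable_weight_bounded[OF assms])
  show "continuous_on {0<..<pi} (\<lambda>\<theta>. of_real (1 + cos \<theta>) powr b * cos (\<mu> * of_real \<theta>))"
    by (intro continuous_intros continuous_on_one_plus_cos_powr)
  fix \<theta> :: real assume \<theta>: "\<theta> \<in> {0<..<pi}"
  show "norm (of_real (1 + cos \<theta>) powr b * cos (\<mu> * of_real \<theta>))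
          \<le> exp (pi * \<bar>Im \<mu>\<bar>) * (1 + cos \<theta>) powr Re b"
    unfolding norm_mult norm_one_plus_cos_powr[OF \<theta>]
    using norm_cos_mult_real_le[of \<theta> \<mu>] \<theta> by (simp add: mult.commute mult_right_mono)
qed

text \<open>The integral of an exact derivative vanishes. Neither coefficient is divided out,
  because the zero of \<open>b - \<mu>\<close> at \<open>\<mu> = b\<close> starts the chain of
  vanishing integrals below.\<close>

lemma cos_integral_rec:
  assumes b: "Re b > - 1 / 2"
  shows "(b + \<mu> + 1) * cos_integral b (\<mu> + 1) = (b - \<mu>) * cos_integral b \<mu>"
proof -
  let ?c = "\<lambda>\<theta>. complex_of_real (cos (\<theta> / 2))"
  let ?w = "\<lambda>\<theta>. complex_of_real (1 + cos \<theta>) powr b"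
  \<comment> \<open>\<open>H\<close> is chosen so that its derivative is \<open>h\<close>; it vanishes at both ends since Re (2 b + 1) > 0.\<close>
  define H where "H = (\<lambda>\<theta>. 2 powr b * 2 * (?c \<theta> powr (2 * b + 1) * sin ((2 * \<mu> + 1) * of_real \<theta> / 2)))"
  define h where "h = (\<lambda>\<theta>. (\<mu> - b) * (?w \<theta> * cos (\<mu> * of_real \<theta>))
      + (b + \<mu> + 1) * (?w \<theta> * cos ((\<mu> + 1) * of_real \<theta>)))"
  have "(h has_integral (H pi - H 0)) {0..pi}"
  proof (rule fundamental_theorem_of_calculus_interior)
    have *: "{0..pi} \<subseteq> {\<theta>. Re (?c \<theta>) \<ge> 0 \<or> Im (?c \<theta>) \<noteq> 0}"
      by (auto intro: cos_ge_zero)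
    show "continuous_on {0..pi} H"
      unfolding H_def by (intro continuous_intros *) (use b in auto)
  next
    fix \<theta> :: real assume \<theta>: "\<theta> \<in> {0<..<pi}"
    have c: "cos (\<theta> / 2) > 0" using \<theta> by (auto intro: cos_gt_zero_pi)
    define x where "x = complex_of_real \<theta>"
    have cx: "?c \<theta> = cos (x / 2)"
      using cos_of_real[of "\<theta> / 2", where ?'a = complex] by (simp add: x_def)
    have np: "cos (x / 2) \<notin> \<real>\<^sub>\<le>\<^sub>0" using c unfolding cx[symmetric] by auto
    have nz: "cos (x / 2) \<noteq> 0" using np by auto
    define D where "D = 2 powr b * 2 *
       (cos (x / 2) powr (2 * b + 1) * ((2 * \<mu> + 1) / 2 * cos ((2 * \<mu> + 1) * x / 2))
        - (2 * b + 1) * cos (x / 2) powr (2 * b) * (sin (x / 2) / 2) * sin ((2 * \<mu> + 1) * x / 2))"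
    have "((\<lambda>x. 2 powr b * 2 * (cos (x / 2) powr (2 * b + 1) * sin ((2 * \<mu> + 1) * x / 2)))
             has_field_derivative D) (at x)"
      unfolding D_def using np nz by (auto intro!: derivative_eq_intros simp: field_simps)
    hence "((\<lambda>t. 2 powr b * 2 * (cos (of_real t / 2) powr (2 * b + 1)
                * sin ((2 * \<mu> + 1) * of_real t / 2)))
             has_vector_derivative D) (at \<theta>)"
      unfolding x_def by (rule has_vector_derivative_real_field)
    moreover have "?c t = cos (of_real t / 2)" for t
      using cos_of_real[of "t / 2", where ?'a = complex] by simp
    ultimately have "(H has_vector_derivative D) (at \<theta>)"
      by (simp add: H_def)
    moreover have "D = h \<theta>"
    proof -
      \<comment> \<open>The frequencies \<open>\<mu>\<close> and \<open>\<mu> + 1\<close> lie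
        symmetrically about \<open>\<mu> + 1 / 2\<close>, so the sum and difference formulas in
        \<open>p\<close> and \<open>q\<close> produce both cosines.\<close>
      define p q where "p = x / 2" and "q = (2 * \<mu> + 1) * x / 2"
      have a: "\<mu> * x = q - p" "(\<mu> + 1) * x = q + p" by (simp_all add: p_def q_def field_simps)
      have "D = 2 powr b * cos p powr (2 * b) *
          ((2 * \<mu> + 1) * (cos p * cos q) - (2 * b + 1) * (sin p * sin q))"
        unfolding D_def using nz by (simp add: p_def q_def powr_add algebra_simps)
      also have "\<dots> = 2 powr b * cos p powr (2 * b) *
          ((\<mu> - b) * cos (q - p) + (b + \<mu> + 1) * cos (q + p))"
        by (simp add: cos_add cos_diff algebra_simps)
      also have "\<dots> = h \<theta>"
        unfolding h_def powr_one_plus_cos_half[OF \<theta>] cx x_def[symmetric] a p_def[symmetric]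
        by (simp add: algebra_simps)
      finally show ?thesis .
    qed
    ultimately show "(H has_vector_derivative h \<theta>) (at \<theta>)" by simp
  qed auto
  moreover have "H pi - H 0 = 0" using b by (auto simp: H_def)
  ultimately have "integral {0<..<pi} h = 0"
    by (simp add: has_integral_Icc_iff_Ioo integral_unique)
  also have "integral {0<..<pi} h = (\<mu> - b) * cos_integral b \<mu> + (b + \<mu> + 1) * cos_integral b (\<mu> + 1)"
    unfolding h_def cos_integral_def
    by (simp only: integral_add integral_mult_right integrable_cos_integral[OF b]
        integrable_on_mult_right)
  finally show ?thesis by (simp add: algebra_simps)
qed

text \<open>At \<open>\<mu> = b\<close> the right side of the recurrence is zero; the coefficient on
  the left has positive real part at every step, so the zero propagates upwards.\<close>

lemma cos_integral_add_eq_0: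
  assumes b: "Re b > - 1 / 2"
  shows "cos_integral b (b + of_nat (Suc j)) = 0"
proof (induction j)
  case 0
  have "b + b + 1 \<noteq> 0" using b by (auto simp: complex_eq_iff)
  thus ?case using cos_integral_rec[OF b, of b] by simp
next
  case (Suc j)
  have "b + (b + of_nat (Suc j)) + 1 \<noteq> 0" using b by (auto simp: complex_eq_iff)
  thus ?case using cos_integral_rec[OF b, of "b + of_nat (Suc j)"] Suc.IH by (simp add: add_ac)
qed

text \<open>Read downwards from \<open>\<mu> = b\<close>, the recurrence is the one satisfied by the
  coefficients of (1 + u)^(2b).\<close>

lemma cos_integral_diff_gchoose:
  assumes b: "Re b > - 1 / 2"
  shows "cos_integral b (b - of_nat k) = cos_integral b b * (2 * b gchoose k)"
proof (induction k)
  case (Suc k)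
  have "(2 * b - of_nat k) * cos_integral b (b - of_nat k) =
      of_nat (Suc k) * cos_integral b (b - of_nat (Suc k))"
    using cos_integral_rec[OF b, of "b - of_nat (Suc k)"] by (simp add: algebra_simps)
  hence "cos_integral b (b - of_nat (Suc k)) =
      cos_integral b b * ((2 * b gchoose k) * (2 * b - of_nat k) / of_nat (Suc k))"
    by (simp add: Suc.IH field_simps del: of_nat_Suc)
  also have "(2 * b gchoose k) * (2 * b - of_nat k) / of_nat (Suc k) = (2 * b gchoose Suc k)"
    using gbinomial_absorption'[of "Suc k" "2 * b"] gbinomial_mult_1[of "2 * b" k]
    by (simp add: field_simps del: of_nat_Suc)
  finally show ?case .
qed simp

section \<open>Diagonal values of the cosine integral\<close>

text \<open>Splitting \<open>(1 + cos x) * cos ((b + 1) * x)\<close> gives the frequencies b, b + 1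
  and b + 2, of which the last two integrate to zero. This carries the diagonal value from
  \<open>Re b > 0\<close> to \<open>Re b > - 1 / 2\<close>.\<close>

lemma cos_integral_shift:
  assumes b: "Re b > - 1 / 2"
  shows "cos_integral b b = 2 * cos_integral (b + 1) (b + 1)"
proof -
  let ?f = "\<lambda>\<mu> \<theta>. complex_of_real (1 + cos \<theta>) powr b * cos (\<mu> * of_real \<theta>)"
  note int = integrable_cos_integral[OF b]
  have "cos_integral (b + 1) (b + 1) =
      integral {0<..<pi} (\<lambda>\<theta>. ?f (b + 1) \<theta> + (1 / 2 * ?f (b + 2) \<theta> + 1 / 2 * ?f b \<theta>))"
    unfolding cos_integral_def
  proof (intro integral_cong)
    fix \<theta> :: real assume \<theta>: "\<theta> \<in> {0<..<pi}"
    have pos: "complex_of_real (1 + cos \<theta>) \<noteq> 0"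
      using one_plus_cos_pos[of \<theta>] \<theta>
      by (metis greaterThanLessThan_iff less_eq_real_def less_numeral_extra(3) of_real_eq_0_iff)
    define y x where "y = (b + 1) * complex_of_real \<theta>" and "x = complex_of_real \<theta>"
    have eq: "(b + 2) * complex_of_real \<theta> = y + x" "b * complex_of_real \<theta> = y - x"
      by (simp_all add: y_def x_def algebra_simps)
    have "complex_of_real (1 + cos \<theta>) powr (b + 1) * cos y =
        of_real (1 + cos \<theta>) powr b * ((1 + cos x) * cos y)"
      using pos by (simp add: powr_add x_def cos_of_real)
    also have "(1 + cos x) * cos y = cos y + (1 / 2 * cos (y + x) + 1 / 2 * cos (y - x))"
      by (simp add: cos_add cos_diff algebra_simps)
    finally show "complex_of_real (1 + cos \<theta>) powr (b + 1) * cos ((b + 1) * of_real \<theta>) =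
        ?f (b + 1) \<theta> + (1 / 2 * ?f (b + 2) \<theta> + 1 / 2 * ?f b \<theta>)"
      unfolding eq y_def[symmetric] by (simp add: algebra_simps)
  qed
  also have "\<dots> = cos_integral b (b + 1) + (1 / 2 * cos_integral b (b + 2) + 1 / 2 * cos_integral b b)"
    unfolding cos_integral_def
    by (simp only: integral_add integral_mult_right int integrable_add integrable_on_mult_right)
  also have "cos_integral b (b + 1) = 0" using cos_integral_add_eq_0[OF b, of 0] by simp
  also have "cos_integral b (b + 2) = 0"
    using cos_integral_add_eq_0[OF b, of 1] by (simp add: numeral_2_eq_2)
  finally have "cos_integral (b + 1) (b + 1) = 1 / 2 * cos_integral b b" by simp
  thus ?thesis by (simp add: mult.commute)
qed

text \<open>Cauchy's formula at the centre of the unit disc, where the function is 1. The branch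
  point -1 lies on the circle itself; \<open>Re a > 0\<close> keeps the power continuous
  there.\<close>

lemma mean_value_one_plus_powr:
  fixes a :: complex
  assumes a: "Re a > 0"
  shows "((\<lambda>t. (1 + exp (2 * of_real pi * \<i> * of_real t)) powr a) has_integral 1) {0..1}"
proof -
  let ?f = "\<lambda>u :: complex. (1 + u) powr a"
  have "((\<lambda>u. ?f u / (u - 0)) has_contour_integral (2 * of_real pi * \<i> * ?f 0)) (circlepath 0 1)"
  proof (rule Cauchy_integral_circlepath)
    have re: "Re u \<ge> -1" if "norm u \<le> 1" for u :: complex
      using that abs_Re_le_cmod[of u] by linarith
    show "continuous_on (cball 0 1) ?f"
    proof (intro continuous_intros)
      show "cball 0 1 \<subseteq> {u :: complex. Re (1 + u) \<ge> 0 \<or> Im (1 + u) \<noteq> 0}"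
        using re by force
    qed (use a in auto)
    have "1 + u \<notin> \<real>\<^sub>\<le>\<^sub>0" if "norm u < 1" for u :: complex
      using that abs_Re_le_cmod[of u] by (auto simp: complex_nonpos_Reals_iff)
    thus "?f holomorphic_on (ball 0 1)"
      by (intro holomorphic_intros) auto
  qed auto
  hence "((\<lambda>t. (2 * of_real pi * \<i>) * ?f (exp (2 * of_real pi * \<i> * of_real t))) has_integral
      (2 * of_real pi * \<i>)) {0..1}"
    unfolding has_contour_integral vector_derivative_circlepath by (simp add: circlepath mult_ac)
  from has_integral_mult_right[OF this, of "1 / (2 * of_real pi * \<i>)"] show ?thesis
    by simp
qed

text \<open>The base has modulus 2 cos(\<theta>/2) and argument \<theta>/2, which is inside (-pi/2,
  pi/2), so the principal power is read off directly.\<close>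

lemma one_plus_cis_powr:
  fixes a :: complex
  assumes \<theta>: "\<theta> \<in> {-pi<..<pi}"
  shows "(1 + exp (\<i> * of_real \<theta>)) powr a =
         2 powr a * of_real (cos (\<theta> / 2)) powr a * exp (\<i> * a * of_real \<theta> / 2)"
proof -
  define c where "c = cos (\<theta> / 2)"
  have c: "c > 0" using \<theta> by (auto simp: c_def intro: cos_gt_zero_pi)
  have "1 + exp (\<i> * of_real \<theta>) = of_real (2 * c) * exp (\<i> * of_real (\<theta> / 2))"
  proof -
    have "of_real (2 * c) = exp (\<i> * of_real (\<theta> / 2)) + exp (- (\<i> * complex_of_real (\<theta> / 2)))"
      by (simp add: c_def cos_of_real[symmetric] cos_exp_eq)
    thus ?thesis by (simp add: distrib_right flip: exp_add)
  qed
  also have "\<dots> powr a = of_real (2 * c) powr a * exp (\<i> * of_real (\<theta> / 2)) powr a"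
    using c by (intro powr_times_real_left) auto
  also have "exp (\<i> * of_real (\<theta> / 2)) powr a = exp (\<i> * a * of_real \<theta> / 2)"
    using \<theta> by (subst exp_powr_complex) (auto simp: mult_ac)
  also have "complex_of_real (2 * c) powr a = 2 powr a * of_real c powr a"
    using c by (simp add: powr_times_real_left)
  finally show ?thesis by (simp add: c_def)
qed

text \<open>The mean value integral is folded at t = 1/2: t = \<theta>/(2 pi) on the first half, t =
  1 - \<theta>/(2 pi) on the second. The opposite phases exp(i b \<theta>) and exp(-i b \<theta>)
  then add up to a cosine.\<close>

lemma cos_integral_diagonal_pos:
  assumes b: "Re b > 0"
  shows "cos_integral b b = of_real pi / 2 powr b"
proof -
  let ?g = "\<lambda>t. (1 + exp (2 * of_real pi * \<i> * of_real t)) powr (2 * b)"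
  let ?G = "\<lambda>\<theta>. (1 + exp (\<i> * complex_of_real \<theta>)) powr (2 * b)"
  have g: "(?g has_integral 1) {0..1}" using b by (intro mean_value_one_plus_powr) auto
  hence i1: "?g integrable_on {0..1/2}" and i2: "?g integrable_on {1/2..1}"
    by (auto intro: integrable_on_subinterval)
  define I1 I2 where "I1 = integral {0..1/2} ?g" and "I2 = integral {1/2..1} ?g"
  have I: "I1 + I2 = 1"
    using Henstock_Kurzweil_Integration.integral_combine[OF _ _ has_integral_integrable[OF g], of "1/2"]
      integral_unique[OF g]
    by (simp add: I1_def I2_def)
  have h1: "(?g has_integral I1) (cbox 0 (1/2))" and h2: "(?g has_integral I2) (cbox (1/2) 1)"
    using i1 i2 by (auto simp: I1_def I2_def integrable_integral)
  have "1 / (2 * pi) \<noteq> 0" "- 1 / (2 * pi) \<noteq> 0" by auto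
  note aff = has_integral_affinity[OF h1 this(1), of 0] has_integral_affinity[OF h2 this(2), of 1]
  have A1: "(?G has_integral (2 * of_real pi) * I1) {0..pi}"
    using aff(1) image_mult_atLeastAtMost[of "pi * 2" 0 "1 / 2"]
    by (simp add: scaleR_conv_of_real mult_ac)
  note aff(2)
  moreover have "(\<lambda>x. (1 / (- 1 / (2 * pi))) *\<^sub>R x + - ((1 / (- 1 / (2 * pi))) *\<^sub>R 1)) ` cbox (1/2) 1 =
      {0..pi}"
    by (subst image_affinity_cbox) (auto dest: leD)
  \<comment> \<open>The shift by 1 in t is a full period of the exponential and drops out.\<close>
  moreover have "?g ((- 1 / (2 * pi)) *\<^sub>R \<theta> + 1) = ?G (- \<theta>)" for \<theta>
  proof -
    have "2 * of_real pi * \<i> * of_real ((- 1 / (2 * pi)) *\<^sub>R \<theta> + 1) =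
        \<i> * complex_of_real (- \<theta>) + 2 * of_real pi * \<i>"
      by (simp add: field_simps)
    thus ?thesis by (simp only: exp_add exp_two_pi_i mult_1_right)
  qed
  ultimately have A2: "((\<lambda>\<theta>. ?G (- \<theta>)) has_integral (2 * of_real pi) * I2) {0..pi}"
    by (simp add: scaleR_conv_of_real mult_ac)
  have "((\<lambda>\<theta>. ?G \<theta> + ?G (- \<theta>)) has_integral 2 * of_real pi * (I1 + I2)) {0<..<pi}"
    using has_integral_add[OF A1 A2] by (simp add: has_integral_Icc_iff_Ioo distrib_left)
  hence "((\<lambda>\<theta>. 2 * 2 powr b * (of_real (1 + cos \<theta>) powr b * cos (b * of_real \<theta>))) has_integral
      2 * of_real pi) {0<..<pi}"
  proof (rule has_integral_eq_rhs[OF has_integral_eq, rotated])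
    fix \<theta> assume \<theta>: "\<theta> \<in> {0<..<pi}"
    have "?G \<theta> + ?G (- \<theta>) =
        2 powr (2 * b) * of_real (cos (\<theta> / 2)) powr (2 * b) * (2 * cos (b * of_real \<theta>))"
    proof -
      define P u where "P = 2 powr (2 * b) * complex_of_real (cos (\<theta> / 2)) powr (2 * b)"
        and "u = \<i> * (b * of_real \<theta>)"
      have "?G \<theta> = P * exp u" "?G (- \<theta>) = P * exp (- u)"
        using \<theta> one_plus_cis_powr[of \<theta> "2 * b"] one_plus_cis_powr[of "- \<theta>" "2 * b"]
        by (simp_all add: P_def u_def mult_ac)
      thus ?thesis by (simp add: cos_exp_eq distrib_left flip: P_def u_def)
    qed
    also have "\<dots> = 2 * 2 powr b * (2 powr b * of_real (cos (\<theta> / 2)) powr (2 * b) * cos (b * of_real \<theta>))"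
    proof -
      have "2 powr (2 * b) = 2 powr b * (2 :: complex) powr b" by (simp only: mult_2 powr_add)
      thus ?thesis by (simp add: mult_ac)
    qed
    finally show "?G \<theta> + ?G (- \<theta>) = 2 * 2 powr b * (of_real (1 + cos \<theta>) powr b * cos (b * of_real \<theta>))"
      by (simp only: powr_one_plus_cos_half[OF \<theta>])
  qed (simp add: I)
  hence "2 * 2 powr b * cos_integral b b = 2 * of_real pi"
    unfolding cos_integral_def by (simp add: integral_unique flip: integral_mult_right)
  thus ?thesis by (simp add: field_simps)
qed

lemma cos_integral_diagonal:
  assumes b: "Re b > - 1 / 2"
  shows "cos_integral b b = of_real pi / 2 powr b"
  using cos_integral_shift[OF b] cos_integral_diagonal_pos[of "b + 1"] b
  by (simp add: powr_add)

subsection \<open>Kummer's second formula\<close>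

text \<open>Iterating the ratio bound gives |d k| <= |C|^k |d 0| / k!, so an exponential series
  dominates.\<close>

lemma summable_of_ratio_Suc:
  fixes d :: "nat \<Rightarrow> 'a::{real_normed_field, banach}" and x :: 'a
  assumes le: "\<And>k. real (Suc k) * norm (d (Suc k)) \<le> C * norm (d k)"
  shows "summable (\<lambda>k. norm (d k * x ^ k))"
proof -
  have bd: "fact k * norm (d k) \<le> \<bar>C\<bar> ^ k * norm (d 0)" for k
  proof (induction k)
    case (Suc k)
    have "fact (Suc k) * norm (d (Suc k)) = fact k * (real (Suc k) * norm (d (Suc k)))"
      by (simp add: algebra_simps)
    also have "\<dots> \<le> fact k * (\<bar>C\<bar> * norm (d k))"
      by (intro mult_left_mono order.trans[OF le] mult_right_mono) auto
    also have "\<dots> \<le> \<bar>C\<bar> * (\<bar>C\<bar> ^ k * norm (d 0))"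
      using mult_left_mono[OF Suc.IH, of "\<bar>C\<bar>"] by (simp add: algebra_simps)
    finally show ?case by (simp add: algebra_simps)
  qed auto
  have "summable (\<lambda>k. norm (d 0) * ((\<bar>C\<bar> * norm x) ^ k /\<^sub>R fact k))"
    by (intro summable_mult summable_exp_generic)
  thus ?thesis
  proof (rule summable_comparison_test')
    fix k :: nat
    have "norm (d k) * norm x ^ k \<le> \<bar>C\<bar> ^ k * norm (d 0) / fact k * norm x ^ k"
      using bd[of k] by (intro mult_right_mono) (auto simp: field_simps)
    thus "norm (norm (d k * x ^ k)) \<le> norm (d 0) * ((\<bar>C\<bar> * norm x) ^ k /\<^sub>R fact k)"
      by (simp add: norm_mult norm_power field_simps power_mult_distrib)
  qed
qed

text \<open>For \<open>Re \<mu> > - 1 / 2\<close> these are the coefficients of 1F1(\<mu> + 1/2; 2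
  \<mu> + 1; 4x) / Gamma(\<mu> + 1), written in the form in which the cosine integrals deliver
  them.\<close>

definition kummer_coeff :: "complex \<Rightarrow> nat \<Rightarrow> complex" where
  "kummer_coeff \<mu> k = rGamma (\<mu> + of_nat k + 1) * pochhammer (2 * \<mu> + of_nat k + 1) k / fact k"

text \<open>Passing to \<open>Suc k\<close> moves both base and length of the Pochhammer symbol. One
  extra factor \<open>y\<close> on the left aligns the two symbols, and the top factor
  \<open>2 * (\<mu> + of_nat k + 1)\<close> is absorbed by the recurrence of
  \<open>rGamma\<close>.\<close>

lemma kummer_coeff_Suc:
  assumes \<mu>: "Re \<mu> > - 1 / 2"
  shows "of_nat (Suc k) * (2 * \<mu> + of_nat (Suc k)) * kummer_coeff \<mu> (Suc k) =
         2 * (2 * \<mu> + 2 * of_nat k + 1) * kummer_coeff \<mu> k"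
proof -
  have r: "rGamma (\<mu> + of_nat k + 1) = (\<mu> + of_nat k + 1) * rGamma (\<mu> + of_nat (Suc k) + 1)"
    using rGamma_plus1[of "\<mu> + of_nat k + 1"] by (simp add: add_ac)
  define y where "y = 2 * \<mu> + of_nat k + 1"
  have "y * pochhammer (y + 1) (Suc k) = pochhammer y (Suc (Suc k))"
    by (simp add: pochhammer_rec)
  also have "\<dots> = pochhammer y k * (y + of_nat k) * (y + of_nat (Suc k))"
    by (simp add: pochhammer_Suc mult_ac)
  also have "\<dots> = pochhammer y k * (2 * \<mu> + 2 * of_nat k + 1) * (2 * (\<mu> + of_nat k + 1))"
    by (simp add: y_def algebra_simps)
  finally have p: "y * pochhammer (y + 1) (Suc k) =
      pochhammer y k * (2 * \<mu> + 2 * of_nat k + 1) * (2 * (\<mu> + of_nat k + 1))" .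
  have y: "2 * \<mu> + of_nat (Suc k) = y" "2 * \<mu> + of_nat (Suc k) + 1 = y + 1" by (simp_all add: y_def)
  have "of_nat (Suc k) * (2 * \<mu> + of_nat (Suc k)) * kummer_coeff \<mu> (Suc k)
      = of_nat (Suc k) * rGamma (\<mu> + of_nat (Suc k) + 1) * (y * pochhammer (y + 1) (Suc k))
          / fact (Suc k)"
    unfolding kummer_coeff_def y by simp
  also have "\<dots> = rGamma (\<mu> + of_nat (Suc k) + 1) * (y * pochhammer (y + 1) (Suc k)) / fact k"
    by (simp add: divide_simps del: of_nat_Suc)
  also have "\<dots> = 2 * (2 * \<mu> + 2 * of_nat k + 1) * kummer_coeff \<mu> k"
    unfolding p kummer_coeff_def r y_def[symmetric]
    by (simp only: times_divide_eq_right times_divide_eq_left mult_ac)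
  finally show ?thesis .
qed

text \<open>With v = 2 \<mu> + k + 1, the factor on the right of the recurrence is 2v + 2k, and k is
  at most Re v; hence the constant 4.\<close>

lemma norm_kummer_coeff_Suc_le:
  assumes \<mu>: "Re \<mu> > - 1 / 2"
  shows "real (Suc k) * norm (kummer_coeff \<mu> (Suc k)) \<le> 4 * norm (kummer_coeff \<mu> k)"
proof -
  define v where "v = 2 * \<mu> + of_nat (Suc k)"
  have "real k \<le> Re v" "0 < Re v" using \<mu> by (auto simp: v_def)
  hence v: "real k \<le> norm v" "0 < norm v"
    using complex_Re_le_cmod[of v] by auto
  have eq: "2 * (2 * \<mu> + 2 * of_nat k + 1) = 2 * v + 2 * of_nat k" by (simp add: v_def)
  have "norm (2 * (2 * \<mu> + 2 * of_nat k + 1)) \<le> 2 * norm v + 2 * real k"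
    unfolding eq using norm_triangle_ineq[of "2 * v" "2 * of_nat k"] by (simp add: norm_mult)
  hence le: "norm (2 * (2 * \<mu> + 2 * of_nat k + 1)) \<le> 4 * norm v" using v by linarith
  have "real (Suc k) * norm v * norm (kummer_coeff \<mu> (Suc k)) =
          norm (2 * (2 * \<mu> + 2 * of_nat k + 1)) * norm (kummer_coeff \<mu> k)"
    using arg_cong[OF kummer_coeff_Suc[OF \<mu>, of k], of norm] by (simp only: norm_mult norm_of_nat v_def)
  also have "\<dots> \<le> 4 * norm v * norm (kummer_coeff \<mu> k)" by (intro mult_right_mono le) auto
  finally show ?thesis using v by (simp add: mult_ac)
qed

text \<open>Kummer's second formula in terms of coefficients: the transformed equation x G'' + c G'
  = 4 x G links only coefficients two apart, so the odd ones vanish and the even ones are those of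
  0F1(; \<mu> + 1; x^2) / Gamma(\<mu> + 1).\<close>

lemma fps_exp_mult_kummer_coeff:
  assumes \<mu>: "Re \<mu> > - 1 / 2"
  defines "G \<equiv> fps_exp (- 2) * Abs_fps (kummer_coeff \<mu>)"
  shows "fps_nth G (2 * j) = rGamma (\<mu> + of_nat j + 1) / fact j"
    and "fps_nth G (Suc (2 * j)) = 0"
proof -
  define F where "F = Abs_fps (kummer_coeff \<mu>)"
  define c where "c = 2 * \<mu> + 1"
  let ?D = fps_deriv
  \<comment> \<open>In \<open>x F'' + c F' = 4 x F' + 2 c F\<close> the factor \<open>exp (- 2 x)\<close> removes the terms that spoil parity.\<close>
  have F: "fps_X * ?D (?D F) + fps_const c * ?D F = fps_const 4 * fps_X * ?D F + fps_const (2 * c) * F"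
  proof (rule fps_ext)
    fix k
    have "fps_nth (fps_X * ?D (?D F) + fps_const c * ?D F) k =
       of_nat (Suc k) * (2 * \<mu> + of_nat (Suc k)) * kummer_coeff \<mu> (Suc k)"
      by (cases k) (simp_all add: F_def c_def mult.assoc algebra_simps)
    also have "\<dots> = 2 * (2 * \<mu> + 2 * of_nat k + 1) * kummer_coeff \<mu> k" by (rule kummer_coeff_Suc[OF \<mu>])
    also have "\<dots> = fps_nth (fps_const 4 * fps_X * ?D F + fps_const (2 * c) * F) k"
      by (cases k) (simp_all add: F_def c_def mult.assoc algebra_simps)
    finally show "fps_nth (fps_X * ?D (?D F) + fps_const c * ?D F) k =
        fps_nth (fps_const 4 * fps_X * ?D F + fps_const (2 * c) * F) k" .
  qed
  define E where "E = fps_exp (- 2 :: complex)"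
  have DE: "?D E = - 2 * E"
    by (simp add: E_def numeral_fps_const fps_const_neg)
  have G: "G = E * F" by (simp add: G_def E_def F_def)
  have DG: "?D G = E * (?D F - 2 * F)" by (simp add: G DE algebra_simps)
  have DDG: "?D (?D G) = E * (?D (?D F) - 4 * ?D F + 4 * F)"
    unfolding DG by (simp add: DE algebra_simps)
  have F': "fps_X * ?D (?D F) = 4 * fps_X * ?D F + 2 * fps_const c * F - fps_const c * ?D F"
    using F by (simp add: numeral_fps_const algebra_simps flip: fps_const_mult)
  have "fps_X * ?D (?D G) + fps_const c * ?D G =
      E * (fps_X * ?D (?D F) - 4 * fps_X * ?D F + 4 * fps_X * F + fps_const c * ?D F
           - 2 * fps_const c * F)"
    unfolding DDG unfolding DG by (simp add: algebra_simps)
  also have "\<dots> = 4 * fps_X * G"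
    unfolding F' by (simp add: G algebra_simps)
  finally have ode: "fps_X * ?D (?D G) + fps_const c * ?D G = fps_const 4 * (fps_X * G)"
    by (simp add: numeral_fps_const mult.assoc)
  \<comment> \<open>For k = 0 there is no term on the right, which forces the coefficient of index 1
    to vanish and starts the odd induction.\<close>
  have rec: "of_nat (Suc k) * (2 * \<mu> + of_nat (Suc k)) * fps_nth G (Suc k) =
      (if k = 0 then 0 else 4 * fps_nth G (k - 1))" for k
  proof -
    have "of_nat (Suc k) * (2 * \<mu> + of_nat (Suc k)) * fps_nth G (Suc k) =
        fps_nth (fps_X * ?D (?D G) + fps_const c * ?D G) k"
      by (cases k) (simp_all add: c_def algebra_simps)
    also have "\<dots> = (if k = 0 then 0 else 4 * fps_nth G (k - 1))"
      unfolding ode by simp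
    finally show ?thesis .
  qed
  have nz: "of_nat (Suc k) * (2 * \<mu> + of_nat (Suc k)) \<noteq> 0" for k
    using \<mu> by (auto simp: complex_eq_iff simp del: of_nat_Suc)
  show "fps_nth G (Suc (2 * j)) = 0"
  proof (induction j)
    case 0 show ?case using rec[of 0] nz[of 0] by auto
  next
    case (Suc j)
    show ?case using rec[of "Suc (Suc (2 * j))"] nz[of "Suc (Suc (2 * j))"] Suc.IH by auto
  qed
  show "fps_nth G (2 * j) = rGamma (\<mu> + of_nat j + 1) / fact j"
  proof (induction j)
    case 0 show ?case by (simp add: G_def kummer_coeff_def)
  next
    case (Suc j)
    have n: "\<mu> + of_nat (Suc j) \<noteq> 0" using \<mu> by (auto simp: complex_eq_iff)
    have "4 * (of_nat (Suc j) * (\<mu> + of_nat (Suc j))) * fps_nth G (2 * Suc j) =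
        4 * (rGamma (\<mu> + of_nat j + 1) / fact j)"
      using rec[of "Suc (2 * j)"] Suc.IH by (simp add: algebra_simps)
    also have "rGamma (\<mu> + of_nat j + 1) = (\<mu> + of_nat (Suc j)) * rGamma (\<mu> + of_nat (Suc j) + 1)"
      using rGamma_plus1[of "\<mu> + of_nat j + 1"] by (simp add: add_ac)
    finally have "4 * (\<mu> + of_nat (Suc j)) * (of_nat (Suc j) * fps_nth G (2 * Suc j)) =
                  4 * (\<mu> + of_nat (Suc j)) * (rGamma (\<mu> + of_nat (Suc j) + 1) / fact j)"
      by (simp only: mult_ac times_divide_eq_right)
    hence "of_nat (Suc j) * fps_nth G (2 * Suc j) = rGamma (\<mu> + of_nat (Suc j) + 1) / fact j"
      using n by (metis mult_cancel_left mult_eq_0_iff zero_neq_numeral)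
    thus ?case by (simp add: field_simps del: of_nat_Suc)
  qed
qed

text \<open>At \<open>x = - \<i> * z / 2\<close> the factor \<open>exp (- 2 * x)\<close> is exp(iz),
  and x^2 = -(z/2)^2 supplies the alternating signs of the Bessel series. Absolute convergence lets
  the formal product be evaluated there.\<close>

lemma kummer_coeff_sums:
  assumes \<mu>: "Re \<mu> > - 1 / 2"
  shows "(\<lambda>k. kummer_coeff \<mu> k * (- \<i> * z / 2) ^ k) sums
         (exp (- \<i> * z) * (\<Sum>k. (-1) ^ k * (z / 2) ^ (2 * k) / fact k * rGamma (\<mu> + of_nat k + 1)))"
proof -
  define x where "x = - \<i> * z / 2"
  define G where "G = fps_exp (- 2) * Abs_fps (kummer_coeff \<mu>)"
  let ?e = "\<lambda>k. (- 2 * x) ^ k /\<^sub>R fact k"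
  let ?d = "\<lambda>k. kummer_coeff \<mu> k * x ^ k"
  have d: "summable (\<lambda>k. norm (?d k))"
    by (rule summable_of_ratio_Suc[OF norm_kummer_coeff_Suc_le[OF \<mu>]])
  have "(\<lambda>k. \<Sum>i\<le>k. ?e i * ?d (k - i)) sums (exp (- 2 * x) * (\<Sum>k. ?d k))"
    using Cauchy_product_sums[OF summable_norm_exp d] by (simp add: exp_def)
  moreover have "(\<Sum>i\<le>k. ?e i * ?d (k - i)) = fps_nth G k * x ^ k" for k
    unfolding G_def fps_mult_nth sum_distrib_right atMost_atLeast0
  proof (intro sum.cong refl, goal_cases)
    case (1 i)
    hence "x ^ k = x ^ i * x ^ (k - i)" by (simp flip: power_add)
    moreover have "?e i = (- 2) ^ i / fact i * x ^ i"
      by (simp only: power_mult_distrib scaleR_conv_of_real) (simp add: field_simps)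
    ultimately show ?case by simp
  qed
  ultimately have "(\<lambda>k. fps_nth G k * x ^ k) sums (exp (- 2 * x) * (\<Sum>k. ?d k))" by simp
  \<comment> \<open>The odd coefficients vanish, so the sum is reindexed along the even
    ones.\<close>
  hence "(\<lambda>j. fps_nth G (2 * j) * x ^ (2 * j)) sums (exp (- 2 * x) * (\<Sum>k. ?d k))"
  proof (subst (asm) sums_mono_reindex[of "\<lambda>j. 2 * j", symmetric], goal_cases)
    case (2 n)
    hence "odd n" by auto
    then obtain j where "n = Suc (2 * j)" by (auto elim: oddE)
    thus ?case using fps_exp_mult_kummer_coeff(2)[OF \<mu>, of j] by (simp add: G_def)
  qed (auto simp: strict_mono_def)
  moreover have "fps_nth G (2 * j) * x ^ (2 * j) =
      (-1) ^ j * (z / 2) ^ (2 * j) / fact j * rGamma (\<mu> + of_nat j + 1)" for j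
  proof -
    have "x ^ 2 = - ((z / 2) ^ 2)" by (simp add: x_def power_divide power_mult_distrib)
    hence "x ^ (2 * j) = (-1) ^ j * (z / 2) ^ (2 * j)"
      by (simp only: power_mult power_minus[of "_ ^ 2"])
    thus ?thesis using fps_exp_mult_kummer_coeff(1)[OF \<mu>, of j] by (simp add: G_def)
  qed
  ultimately have "(\<lambda>k. (-1) ^ k * (z / 2) ^ (2 * k) / fact k * rGamma (\<mu> + of_nat k + 1)) sums
      (exp (- 2 * x) * (\<Sum>k. ?d k))"
    by simp
  hence "(\<Sum>k. (-1) ^ k * (z / 2) ^ (2 * k) / fact k * rGamma (\<mu> + of_nat k + 1)) =
      exp (- 2 * x) * (\<Sum>k. ?d k)"
    by (rule sums_unique[symmetric])
  moreover have "exp (- \<i> * z) * exp (- 2 * x) = 1"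
    by (simp add: x_def flip: exp_add)
  ultimately have "(\<Sum>k. ?d k) =
      exp (- \<i> * z) * (\<Sum>k. (-1) ^ k * (z / 2) ^ (2 * k) / fact k * rGamma (\<mu> + of_nat k + 1))"
    by (simp flip: mult.assoc)
  thus ?thesis
    using summable_sums[OF summable_norm_cancel[OF d]] by (simp add: x_def)
qed

subsection \<open>The Bessel integral\<close>

text \<open>The constant 2 comes from Re(a + n + 1) > n + 1/2 >= (n + 1)/2.\<close>

lemma norm_rGamma_shift_Suc_le:
  fixes a :: complex
  assumes a: "Re a > - 1 / 2"
  shows "real (Suc n) * norm (rGamma (a + of_nat (Suc n) + 1)) \<le> 2 * norm (rGamma (a + of_nat n + 1))"
proof -
  define v where "v = a + of_nat n + 1"
  have "real (Suc n) \<le> 2 * Re v" using a by (simp add: v_def)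
  hence v: "real (Suc n) \<le> 2 * norm v" using complex_Re_le_cmod[of v] by linarith
  have "real (Suc n) * norm (rGamma (v + 1)) \<le> 2 * norm v * norm (rGamma (v + 1))"
    by (intro mult_right_mono v) auto
  also have "\<dots> = 2 * norm (rGamma v)"
    using rGamma_plus1[of v] by (simp add: norm_mult mult.assoc flip: norm_mult)
  finally show ?thesis by (simp add: v_def add_ac)
qed

lemma summable_gamma_star_series:
  fixes a s :: complex
  assumes "Re a > - 1 / 2"
  shows "summable (\<lambda>n. norm (s ^ n * rGamma (a + of_nat n + 1)))"
  using summable_of_ratio_Suc[OF norm_rGamma_shift_Suc_le[OF assms], of s] by (simp add: mult.commute)

lemma continuous_on_gamma_star:
  assumes a: "Re a > - 1 / 2"
  shows "continuous_on A (gamma_star a)"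
proof (rule continuous_at_imp_continuous_on, intro ballI)
  fix s :: complex
  have "summable (\<lambda>n. rGamma (a + of_nat n + 1) * y ^ n)" for y
    using summable_norm_cancel[OF summable_gamma_star_series[OF a, of y]] by (simp add: mult.commute)
  hence "isCont (\<lambda>s. \<Sum>n. rGamma (a + of_nat n + 1) * s ^ n) s"
    by (rule isCont_powser_converges_everywhere)
  thus "isCont (gamma_star a) s"
    unfolding gamma_star_def by (intro continuous_intros) (simp add: mult.commute)
qed

text \<open>The first statement kills the first m terms of the integrated series of
  \<open>gamma_star\<close>; the second brings the others to the shape of
  \<open>kummer_coeff\<close>.\<close>

lemma cos_integral_add_of_nat:
  assumes a: "Re a > - 1 / 2"
  shows "n < m \<Longrightarrow> cos_integral (a + of_nat n) (a + of_nat m) = 0"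
    and "cos_integral (a + of_nat (m + k)) (a + of_nat m) =
           of_real pi / 2 powr (a + of_nat (m + k)) *
             (pochhammer (2 * (a + of_nat m) + of_nat k + 1) k / fact k)"
proof -
  assume "n < m"
  hence "m = n + Suc (m - Suc n)" by simp
  hence eq: "a + of_nat m = (a + of_nat n) + of_nat (Suc (m - Suc n))" by (metis add.assoc of_nat_add)
  show "cos_integral (a + of_nat n) (a + of_nat m) = 0"
    by (subst eq, rule cos_integral_add_eq_0) (use a in simp)
next
  let ?b = "a + of_nat (m + k)"
  have b: "Re ?b > - 1 / 2" using a by simp
  have "a + of_nat m = ?b - of_nat k" by simp
  hence "cos_integral ?b (a + of_nat m) = of_real pi / 2 powr ?b * (2 * ?b gchoose k)"
    by (simp only: cos_integral_diff_gchoose[OF b] cos_integral_diagonal[OF b])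
  also have "(2 * ?b gchoose k) = pochhammer (2 * (a + of_nat m) + of_nat k + 1) k / fact k"
    by (simp add: gbinomial_pochhammer' algebra_simps)
  finally show "cos_integral ?b (a + of_nat m) =
     of_real pi / 2 powr ?b * (pochhammer (2 * (a + of_nat m) + of_nat k + 1) k / fact k)" .
qed

text \<open>The factor \<open>exp (- s)\<close> of \<open>gamma_star\<close> at s = -iz(1 + cos
  \<theta>), multiplied by exp(-iz cos \<theta>), is exp(iz), free of \<theta>; what is left is a
  power series in 1 + cos \<theta>, integrated term by term.\<close>

lemma integral_gamma_star_cos_sums:
  fixes a z :: complex and m :: nat
  assumes a: "Re a > - 1 / 2"
  defines "\<mu> \<equiv> a + of_nat m"
  shows "(\<lambda>n. exp (\<i> * z) * (- \<i> * z) ^ n * rGamma (a + of_nat n + 1) *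
           cos_integral (a + of_nat n) \<mu>) sums
         integral {0<..<pi} (\<lambda>\<theta>. of_real (1 + cos \<theta>) powr a *
           (gamma_star a (- \<i> * z * of_real (1 + cos \<theta>)) * exp (- \<i> * z * of_real (cos \<theta>)) *
               cos (\<mu> * of_real \<theta>)))"
proof -
  let ?w = "\<lambda>\<theta>. complex_of_real (1 + cos \<theta>) powr a"
  let ?x = "\<lambda>\<theta>. - \<i> * z * complex_of_real (1 + cos \<theta>)"
  let ?r = "\<lambda>n. rGamma (a + of_nat n + 1)"
  define f where "f = (\<lambda>n \<theta>. exp (\<i> * z) * (?x \<theta> ^ n * ?r n) * cos (\<mu> * of_real \<theta>))"
  define M where "M = (\<lambda>n. norm (exp (\<i> * z)) * norm ((2 * z) ^ n * ?r n) * exp (pi * \<bar>Im \<mu>\<bar>))"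
  have sums: "(\<lambda>n. f n \<theta>) sums
      (gamma_star a (?x \<theta>) * exp (- \<i> * z * of_real (cos \<theta>)) * cos (\<mu> * of_real \<theta>))" for \<theta>
  proof -
    have "(\<lambda>n. ?x \<theta> ^ n * ?r n) sums (\<Sum>n. ?x \<theta> ^ n * ?r n)"
      by (rule summable_sums[OF summable_norm_cancel[OF summable_gamma_star_series[OF a]]])
    from sums_mult2[OF sums_mult[OF this, of "exp (\<i> * z)"], of "cos (\<mu> * of_real \<theta>)"]
    have "(\<lambda>n. f n \<theta>) sums (exp (\<i> * z) * (\<Sum>n. ?x \<theta> ^ n * ?r n) * cos (\<mu> * of_real \<theta>))"
      unfolding f_def .
    moreover have "exp (\<i> * z) = exp (- ?x \<theta>) * exp (- \<i> * z * of_real (cos \<theta>))"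
      unfolding exp_add[symmetric] by (simp add: algebra_simps)
    ultimately show ?thesis by (simp add: gamma_star_def mult_ac)
  qed
  have fle: "norm (f n \<theta>) \<le> M n" if \<theta>: "\<theta> \<in> {0<..<pi}" for n \<theta>
  proof -
    have "norm (?x \<theta>) \<le> norm (2 * z)"
    proof -
      have "norm (complex_of_real (1 + cos \<theta>)) \<le> 2"
        using one_plus_cos_pos[of \<theta>] \<theta> by (simp only: norm_of_real) simp
      hence "norm z * norm (complex_of_real (1 + cos \<theta>)) \<le> norm z * 2"
        by (intro mult_left_mono) auto
      thus ?thesis by (simp add: norm_mult mult.commute)
    qed
    hence "norm (?x \<theta>) ^ n \<le> norm (2 * z) ^ n" by (intro power_mono) auto
    thus ?thesis using norm_cos_mult_real_le[of \<theta> \<mu>] \<theta>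
      unfolding f_def M_def norm_mult norm_power
      by (intro mult_mono mult_nonneg_nonneg) auto
  qed
  have M: "summable M"
    unfolding M_def by (intro summable_mult summable_mult2 summable_gamma_star_series a)
  have "(\<lambda>n. integral {0<..<pi} (\<lambda>\<theta>. ?w \<theta> * f n \<theta>)) sums
      integral {0<..<pi} (\<lambda>\<theta>. ?w \<theta> * (gamma_star a (?x \<theta>) * exp (- \<i> * z * of_real (cos \<theta>)) *
          cos (\<mu> * of_real \<theta>)))"
  proof (rule integral_series_weight_bounded(2)[OF a continuous_on_one_plus_cos_powr _ _ fle M sums])
    show "norm (?w \<theta>) \<le> 1 * (1 + cos \<theta>) powr Re a" if "\<theta> \<in> {0<..<pi}" for \<theta>
      using norm_one_plus_cos_powr[OF that, of a] by simp
    show "continuous_on {0<..<pi} (f n)" for n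
      unfolding f_def by (intro continuous_intros)
  qed auto
  moreover have "integral {0<..<pi} (\<lambda>\<theta>. ?w \<theta> * f n \<theta>) =
      exp (\<i> * z) * (- \<i> * z) ^ n * ?r n * cos_integral (a + of_nat n) \<mu>" for n
    unfolding cos_integral_def integral_mult_right[symmetric]
  proof (intro integral_cong)
    fix \<theta> :: real assume \<theta>: "\<theta> \<in> {0<..<pi}"
    have "complex_of_real (1 + cos \<theta>) \<noteq> 0"
      using one_plus_cos_pos[of \<theta>] \<theta> by (simp only: of_real_eq_0_iff) auto
    hence "complex_of_real (1 + cos \<theta>) powr (a + of_nat n) = ?w \<theta> * complex_of_real (1 + cos \<theta>) ^ n"
      by (simp add: powr_add del: of_real_add)
    thus "?w \<theta> * f n \<theta> = exp (\<i> * z) * (- \<i> * z) ^ n * ?r n *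
            (complex_of_real (1 + cos \<theta>) powr (a + of_nat n) * cos (\<mu> * of_real \<theta>))"
      by (simp only: f_def power_mult_distrib mult_ac)
  qed
  ultimately show ?thesis by simp
qed

text \<open>After the m vanishing terms the series is (-iz)^m times a Kummer series, whose factor
  exp(-iz) cancels the exp(iz) in front. The factor \<open>\<i> ^ m\<close> compensates that power
  of -i.\<close>

lemma bessel_J_eq_integral_gamma_star:
  fixes a z :: complex and m :: nat
  assumes a: "Re a > - 1 / 2" and z: "z \<noteq> 0"
  defines "\<mu> \<equiv> a + of_nat m"
  shows "bessel_J \<mu> z = \<i> ^ m * z powr a / of_real pi *
         integral {0<..<pi} (\<lambda>\<theta>. of_real (1 + cos \<theta>) powr a *
           (gamma_star a (- \<i> * z * of_real (1 + cos \<theta>)) * exp (- \<i> * z * of_real (cos \<theta>)) *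
               cos (\<mu> * of_real \<theta>)))"
    (is "_ = _ * ?I")
proof -
  define t where "t = (\<lambda>n. exp (\<i> * z) * (- \<i> * z) ^ n * rGamma (a + of_nat n + 1) *
      cos_integral (a + of_nat n) \<mu>)"
  define S where "S = (\<Sum>k. (-1) ^ k * (z / 2) ^ (2 * k) / fact k * rGamma (\<mu> + of_nat k + 1))"
  have \<mu>: "Re \<mu> > - 1 / 2" using a by (simp add: \<mu>_def)
  have "t n = 0" if "n < m" for n
    using cos_integral_add_of_nat(1)[OF a that] by (simp add: t_def \<mu>_def)
  moreover have "t sums ?I"
    using integral_gamma_star_cos_sums[OF a, of z m] by (simp add: t_def \<mu>_def)
  ultimately have "(\<lambda>k. t (k + m)) sums ?I"
    using sums_zero_iff_shift[of m t ?I] by simp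
  moreover have "t (k + m) = exp (\<i> * z) * of_real pi * (- \<i> * z) ^ m / 2 powr \<mu> *
      (kummer_coeff \<mu> k * (- \<i> * z / 2) ^ k)" for k
  proof -
    have "cos_integral (a + of_nat (k + m)) \<mu> =
        of_real pi / 2 powr (\<mu> + of_nat k) * (pochhammer (2 * \<mu> + of_nat k + 1) k / fact k)"
      using cos_integral_add_of_nat(2)[OF a, of m k] by (simp add: \<mu>_def add_ac)
    moreover have "a + of_nat (k + m) + 1 = \<mu> + of_nat k + 1" by (simp add: \<mu>_def)
    moreover have "2 powr (\<mu> + of_nat k) = 2 powr \<mu> * 2 ^ k" by (simp add: powr_add)
    moreover have "(- \<i> * z) ^ (k + m) = (- \<i> * z / 2) ^ k * 2 ^ k * (- \<i> * z) ^ m"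
      unfolding power_add power_mult_distrib[symmetric] by simp
    ultimately show ?thesis
      unfolding t_def kummer_coeff_def by (simp only:) (simp add: mult_ac)
  qed
  ultimately have "(\<lambda>k. exp (\<i> * z) * of_real pi * (- \<i> * z) ^ m / 2 powr \<mu> *
      (kummer_coeff \<mu> k * (- \<i> * z / 2) ^ k)) sums ?I"
    by simp
  moreover have "(\<lambda>k. exp (\<i> * z) * of_real pi * (- \<i> * z) ^ m / 2 powr \<mu> *
      (kummer_coeff \<mu> k * (- \<i> * z / 2) ^ k))
      sums (exp (\<i> * z) * of_real pi * (- \<i> * z) ^ m / 2 powr \<mu> * (exp (- \<i> * z) * S))"
    unfolding S_def by (intro sums_mult kummer_coeff_sums \<mu>)
  ultimately have "?I = exp (\<i> * z) * of_real pi * (- \<i> * z) ^ m / 2 powr \<mu> * (exp (- \<i> * z) * S)"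
    by (rule sums_unique2)
  also have "\<dots> = (exp (\<i> * z) * exp (- \<i> * z)) * (of_real pi * (- \<i> * z) ^ m / 2 powr \<mu> * S)"
    by (simp add: mult_ac)
  also have "exp (\<i> * z) * exp (- \<i> * z) = 1" by (simp flip: exp_add)
  finally have I: "?I = of_real pi * (- \<i> * z) ^ m / 2 powr \<mu> * S" by simp
  \<comment> \<open>A positive real factor may be taken out of a principal power.\<close>
  have "2 powr \<mu> * (z / 2) powr \<mu> = z powr \<mu>"
    using powr_times_real_left[of 2 "z / 2" \<mu>] by simp
  hence "(z / 2) powr \<mu> = z powr \<mu> / 2 powr \<mu>" by (simp add: field_simps)
  moreover have "z powr \<mu> = z powr a * z ^ m" using z by (simp add: \<mu>_def powr_add)
  ultimately have J: "bessel_J \<mu> z = z powr a * z ^ m / 2 powr \<mu> * S"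
    by (simp add: bessel_J_def S_def)
  have "\<i> ^ m * (- \<i> * z) ^ m = z ^ m" by (simp flip: power_mult_distrib)
  thus ?thesis unfolding I J by (simp add: mult_ac)
qed

section \<open>Summation of the cosine series\<close>

text \<open>Euler's formula splits the sum into two geometric series with ratios q exp(2ix) and q
  exp(-2ix), both of modulus |q| since x is real; the denominator is the product of theirs.\<close>

lemma cos_arith_progression_sums:
  fixes q \<nu> x :: complex
  assumes q: "norm q < 1" and x: "x \<in> \<real>"
  shows "(\<lambda>n. q ^ n * cos ((\<nu> + 2 * of_nat n) * x)) sums
         ((cos (\<nu> * x) - q * cos ((\<nu> - 2) * x)) / (1 - 2 * q * cos (2 * x) + q ^ 2))"
proof -
  define A B E E' where "A = exp (\<i> * (\<nu> * x))" and "B = exp (- (\<i> * (\<nu> * x)))"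
    and "E = exp (\<i> * (2 * x))" and "E' = exp (- (\<i> * (2 * x)))"
  have ne: "norm (q * E) < 1" "norm (q * E') < 1"
    using q x by (auto simp: norm_mult E_def E'_def Reals_def)
  have nz: "1 - q * E \<noteq> 0" "1 - q * E' \<noteq> 0" using ne by auto
  have EE: "E * E' = 1" by (simp add: E_def E'_def flip: exp_add)
  have "(\<lambda>n. (A * (q * E) ^ n + B * (q * E') ^ n) / 2) sums
      ((A * (1 / (1 - q * E)) + B * (1 / (1 - q * E'))) / 2)"
    by (intro sums_divide sums_add sums_mult geometric_sums ne)
  moreover have "(A * (q * E) ^ n + B * (q * E') ^ n) / 2 = q ^ n * cos ((\<nu> + 2 * of_nat n) * x)" for n
  proof -
    have e: "A * E ^ n = exp (\<i> * ((\<nu> + 2 * of_nat n) * x))"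
      "B * E' ^ n = exp (- (\<i> * ((\<nu> + 2 * of_nat n) * x)))"
      by (simp_all add: A_def B_def E_def E'_def algebra_simps flip: exp_add exp_of_nat_mult)
    show ?thesis unfolding cos_exp_eq e[symmetric] by (simp add: power_mult_distrib field_simps)
  qed
  moreover have "(A * (1 / (1 - q * E)) + B * (1 / (1 - q * E'))) / 2 =
      (cos (\<nu> * x) - q * cos ((\<nu> - 2) * x)) / (1 - 2 * q * cos (2 * x) + q ^ 2)"
  proof -
    have c: "cos (\<nu> * x) = (A + B) / 2" "cos (2 * x) = (E + E') / 2"
      by (simp_all add: cos_exp_eq A_def B_def E_def E'_def)
    have "cos ((\<nu> - 2) * x) = (A * E' + B * E) / 2"
      by (simp add: cos_exp_eq A_def B_def E_def E'_def algebra_simps flip: exp_add)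
    moreover have "1 - 2 * q * cos (2 * x) + q ^ 2 = (1 - q * E) * (1 - q * E')"
    proof -
      have "(1 - q * E) * (1 - q * E') = 1 - q * (E + E') + (E * E') * q ^ 2"
        by (simp add: algebra_simps power2_eq_square)
      thus ?thesis by (simp add: c EE)
    qed
    ultimately show ?thesis using nz unfolding c
      by (simp add: divide_simps) (simp add: algebra_simps)
  qed
  ultimately show ?thesis by (simp only:)
qed

subsection \<open>The Lommel function\<close>

lemma trunc_int_nonneg:
  assumes "x > - 1"
  shows "trunc_int x \<ge> 0"
  using assms by (auto simp: trunc_int_def less_ceiling_iff)

text \<open>For negative \<open>Re \<nu>\<close> truncation toward zero gives 0, so the fractional
  part is \<open>\<nu>\<close> itself and m = 0; otherwise its real part is nonnegative. In both
  cases it meets the bound of the Bessel integral.\<close>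

lemma cfrac_part_decomp:
  assumes \<nu>: "Re \<nu> > - 1 / 2"
  obtains m :: nat where "\<nu> = cfrac_part \<nu> + of_nat m" "Re (cfrac_part \<nu>) > - 1 / 2"
proof
  let ?m = "nat (trunc_int (Re \<nu>))"
  have "trunc_int (Re \<nu>) \<ge> 0" using \<nu> by (intro trunc_int_nonneg) auto
  hence "complex_of_int (trunc_int (Re \<nu>)) = of_nat ?m" by (metis of_int_of_nat_eq nat_0_le)
  thus "\<nu> = cfrac_part \<nu> + of_nat ?m" by (simp add: cfrac_part_def)
  show "Re (cfrac_part \<nu>) > - 1 / 2"
  proof (cases "Re \<nu> \<ge> 0")
    case True
    have "real_of_int \<lfloor>Re \<nu>\<rfloor> \<le> Re \<nu>" by simp
    thus ?thesis using True by (simp add: cfrac_part_def trunc_int_def) linarith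
  next
    case False
    hence "\<lceil>Re \<nu>\<rceil> = 0" using \<nu> by (intro ceiling_unique) auto
    thus ?thesis using False \<nu> by (simp add: cfrac_part_def trunc_int_def)
  qed
qed

text \<open>With the phase \<open>Arg z - pi / 2\<close> the rotation by -i contributes exactly
  exp(-i pi a / 2), even where that phase leaves the principal range.\<close>

lemma phase_powr_rotated_mult_real:
  fixes a z :: complex
  assumes z: "z \<noteq> 0" and c: "c > 0"
  shows "phase_powr (Arg z - pi / 2) (- \<i> * z * of_real c) a =
         z powr a * exp (- (\<i> * of_real pi * a / 2)) * of_real c powr a"
proof (cases "a = 0")
  case True
  thus ?thesis using z c by (simp add: phase_powr_def)
next
  case False
  have "norm (- \<i> * z * of_real c) = norm z * c" using c by (simp add: norm_mult)
  moreover have "complex_of_real (norm z * c) powr a =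
      exp (a * (of_real (ln (norm z)) + of_real (ln c)))"
    using z c by (simp add: powr_def Ln_of_real ln_mult flip: of_real_mult)
  moreover have "Ln z = of_real (ln (norm z)) + \<i> * of_real (Arg z)"
    using z by (simp add: complex_eq_iff Arg_eq_Im_Ln)
  moreover have "complex_of_real c powr a = exp (a * of_real (ln c))"
    using c by (simp add: powr_def Ln_of_real)
  ultimately show ?thesis
    using z False by (simp add: phase_powr_def powr_def exp_add[symmetric] algebra_simps)
qed

lemma i_power_eq_exp: "\<i> ^ m = exp (\<i> * of_real pi * of_nat m / 2)"
proof -
  have "\<i> = exp (\<i> * of_real pi / 2)"
    using cis_pi_half by (simp add: cis_conv_exp)
  hence "\<i> ^ m = exp (\<i> * of_real pi / 2) ^ m" by simp
  also have "\<dots> = exp (of_nat m * (\<i> * of_real pi / 2))" by (rule exp_of_nat_mult[symmetric])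
  finally show ?thesis by (simp add: mult_ac)
qed

text \<open>\<open>suminf\<close> and \<open>integral\<close> are total, so summability and
  integrability are asserted along with the formula. \<open>L\<close> fixes one determination of the
  power of \<open>w / z\<close> on both sides.\<close>

theorem mainTheorem5:
  fixes \<nu> w z L :: complex
  assumes "Re \<nu> > - 1 / 2"
    and "w \<noteq> 0" and "z \<noteq> 0" and "norm (w / z) < 1"
    and "\<nu> \<notin> \<nat> \<longrightarrow> z \<notin> \<real>\<^sub>\<le>\<^sub>0"
    and "exp L = w / z"
  shows "summable (lommel_U_term L \<nu> w z) \<and>
         lommel_integrand \<nu> w z integrable_on {0..pi} \<and>
         lommel_U L \<nu> w z =
           exp (\<i> * of_real pi * \<nu> / 2) / of_real pi * exp (\<nu> * L) *
           integral {0..pi} (lommel_integrand \<nu> w z)"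
proof -
  define a where "a = cfrac_part \<nu>"
  obtain m where \<nu>: "\<nu> = a + of_nat m" and a: "Re a > - 1 / 2"
    using cfrac_part_decomp[OF assms(1)] unfolding a_def by metis
  define q where "q = (w / z) ^ 2"
  have q: "norm q < 1"
    unfolding q_def norm_power using assms(4) by (simp only: abs_square_less_1 abs_norm_cancel)
  \<comment> \<open>\<open>v\<close> collects factors continuous on the closed interval; the
    possible singularity at pi is left to the power in \<open>u\<close>.\<close>
  define v where "v = (\<lambda>\<theta>. gamma_star a (- \<i> * z * of_real (1 + cos \<theta>)) *
      exp (- \<i> * z * of_real (cos \<theta>)))"
  define u where "u = (\<lambda>\<theta>. complex_of_real (1 + cos \<theta>) powr a * v \<theta>)"
  define f where "f = (\<lambda>n \<theta>. q ^ n * cos ((\<nu> + 2 * of_nat n) * complex_of_real \<theta>))"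
  define F where "F = (\<lambda>\<theta>. (cos (\<nu> * of_real \<theta>) - q * cos ((\<nu> - 2) * of_real \<theta>)) /
      (1 - 2 * q * of_real (cos (2 * \<theta>)) + q ^ 2))"
  have v: "continuous_on A v" for A
    unfolding v_def
    by (intro continuous_intros continuous_on_compose2[OF continuous_on_gamma_star[OF a, of UNIV]])
       auto
  obtain C where C: "\<And>\<theta>. \<theta> \<in> {0..pi} \<Longrightarrow> norm (v \<theta>) \<le> C"
    using compact_imp_bounded[OF compact_continuous_image[OF v compact_Icc[of 0 pi]]]
    unfolding bounded_iff by blast
  have u: "continuous_on {0<..<pi} u"
    unfolding u_def by (intro continuous_intros continuous_on_one_plus_cos_powr v)
  have ule: "norm (u \<theta>) \<le> C * (1 + cos \<theta>) powr Re a" if "\<theta> \<in> {0<..<pi}" for \<theta>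
    using mult_right_mono[OF C[of \<theta>], of "(1 + cos \<theta>) powr Re a"] that
    unfolding u_def norm_mult norm_one_plus_cos_powr[OF that] by (simp add: mult.commute)
  have f: "continuous_on {0<..<pi} (f n)" for n
    unfolding f_def by (intro continuous_intros)
  have fle: "norm (f n \<theta>) \<le> norm q ^ n * exp (pi * \<bar>Im \<nu>\<bar>)" if "\<theta> \<in> {0<..<pi}" for n \<theta>
    using norm_cos_mult_real_le[of \<theta> "\<nu> + 2 * of_nat n"] that
    unfolding f_def norm_mult norm_power by (intro mult_left_mono) auto
  have M: "summable (\<lambda>n. norm q ^ n * exp (pi * \<bar>Im \<nu>\<bar>))"
    using q by (intro summable_mult2 summable_geometric) auto
  have fs: "(\<lambda>n. f n \<theta>) sums F \<theta>" for \<theta>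
    using cos_arith_progression_sums[OF q, of "of_real \<theta>" \<nu>]
      cos_of_real[of "2 * \<theta>", where ?'a = complex]
    by (simp add: f_def F_def)
  note series = integral_series_weight_bounded[OF a u ule f fle M fs]

  define K where "K = \<i> ^ m * z powr a / of_real pi"
  have coeff: "lommel_U_term L \<nu> w z n = exp (\<nu> * L) * K * integral {0<..<pi} (\<lambda>\<theta>. u \<theta> * f n \<theta>)" for n
  proof -
    have "bessel_J (\<nu> + 2 * of_nat n) z = bessel_J (a + of_nat (m + 2 * n)) z"
      by (simp add: \<nu> add_ac)
    also have "\<dots> = \<i> ^ (m + 2 * n) * z powr a / of_real pi *
        integral {0<..<pi} (\<lambda>\<theta>. of_real (1 + cos \<theta>) powr a *
          (v \<theta> * cos ((\<nu> + 2 * of_nat n) * of_real \<theta>)))"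
      unfolding bessel_J_eq_integral_gamma_star[OF a assms(3)] v_def by (simp add: \<nu> add_ac)
    also have "\<i> ^ (m + 2 * n) = (- 1) ^ n * \<i> ^ m"
      by (simp add: power_add power_mult)
    finally have J: "bessel_J (\<nu> + 2 * of_nat n) z = (- 1) ^ n * \<i> ^ m * z powr a / of_real pi *
        integral {0<..<pi} (\<lambda>\<theta>. of_real (1 + cos \<theta>) powr a *
          (v \<theta> * cos ((\<nu> + 2 * of_nat n) * of_real \<theta>)))" .
    have q: "(w / z) ^ (2 * n) = q ^ n" by (simp only: q_def power_mult)
    have "lommel_U_term L \<nu> w z n = ((- 1) ^ n * (- 1) ^ n) * (exp (\<nu> * L) * K) *
        (q ^ n * integral {0<..<pi} (\<lambda>\<theta>. of_real (1 + cos \<theta>) powr a *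
          (v \<theta> * cos ((\<nu> + 2 * of_nat n) * of_real \<theta>))))"
      unfolding lommel_U_term_def J K_def q by (simp add: mult_ac)
    \<comment> \<open>The sign of the Neumann series meets the one coming from
      \<open>\<i> ^ (2 * n)\<close>; they cancel, so the geometric series runs in powers of
      \<open>q\<close> and not of its negative.\<close>
    also have "(- 1) ^ n * (- 1) ^ n = (1 :: complex)" by (simp flip: power_mult_distrib)
    also have "q ^ n * integral {0<..<pi} (\<lambda>\<theta>. of_real (1 + cos \<theta>) powr a *
          (v \<theta> * cos ((\<nu> + 2 * of_nat n) * of_real \<theta>))) =
        integral {0<..<pi} (\<lambda>\<theta>. u \<theta> * f n \<theta>)"
      unfolding integral_mult_right[symmetric] by (intro integral_cong) (simp add: u_def f_def mult_ac)
    finally show ?thesis by simp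
  qed
  have U: "lommel_U_term L \<nu> w z sums (exp (\<nu> * L) * K * integral {0<..<pi} (\<lambda>\<theta>. u \<theta> * F \<theta>))"
    unfolding coeff by (intro sums_mult series(2))

  define B where "B = z powr a * exp (- (\<i> * of_real pi * a / 2))"
  \<comment> \<open>The endpoint pi is left out: there the \<open>powr\<close> in \<open>u\<close>
    yields 0 even if a = 0, where \<open>phase_powr\<close> yields 1.\<close>
  have integrand: "lommel_integrand \<nu> w z \<theta> = B * (u \<theta> * F \<theta>)" if \<theta>: "\<theta> \<in> {0<..<pi}" for \<theta>
  proof -
    have "1 + cos \<theta> > 0" using one_plus_cos_pos \<theta> by auto
    note p = phase_powr_rotated_mult_real[OF assms(3) this, of a]
    have "(w / z) ^ 4 = q ^ 2" by (simp add: q_def flip: power_mult)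
    thus ?thesis
      unfolding lommel_integrand_def reg_inc_gamma_def a_def[symmetric] p
      by (simp add: u_def v_def F_def B_def q_def)
  qed
  have "((\<lambda>\<theta>. B * (u \<theta> * F \<theta>)) has_integral B * integral {0<..<pi} (\<lambda>\<theta>. u \<theta> * F \<theta>)) {0<..<pi}"
    by (intro has_integral_mult_right integrable_integral series(1))
  hence I: "(lommel_integrand \<nu> w z has_integral B * integral {0<..<pi} (\<lambda>\<theta>. u \<theta> * F \<theta>)) {0..pi}"
    unfolding has_integral_Icc_iff_Ioo by (rule has_integral_eq[rotated]) (simp add: integrand)
  \<comment> \<open>The phase split off from the power of -iz reduces the \<nu>-th power of i to the
    integer power in \<open>K\<close>.\<close>
  have "exp (\<i> * of_real pi * \<nu> / 2) * exp (- (\<i> * of_real pi * a / 2)) = \<i> ^ m"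
    unfolding i_power_eq_exp exp_add[symmetric] \<nu> by (simp add: field_simps)
  hence "K = exp (\<i> * of_real pi * \<nu> / 2) / of_real pi * B"
    by (simp add: K_def B_def mult_ac)
  thus ?thesis
    using U I by (auto simp: lommel_U_def sums_iff has_integral_iff mult_ac)
qed

end
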